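(* Let $E$ be a universally complete Archimedean complex vector lattice with multiplicative identity $e$, and let $\sum_{n=0}^{\infty}a_n$ be a series in $E$. (i) If the sequence $(|a_n|^{1/n})_{n\geq 1}$ is order bounded and $\limsup_{n\to\infty}|a_n|^{1/n}\ll e$, then the series $\sum_{n=0}^{\infty}a_n$ converges absolutely in order. (ii) If the series $\sum_{n=0}^{\infty}a_n$ converges in order, then the sequence $(|a_n|^{1/n})_{n\geq 1}$ is order bounded and $\limsup_{n\to\infty}|a_n|^{1/n}\leq e$. (iii) If $(|a_n|^{1/n})_{n\geq 1}$ is order bounded and both $\limsup_{n\to\infty}|a_n|^{1/n}\not\ll e$ and $\limsup_{n\to\infty}|a_n|^{1/n}\leq e$ hold, then this test is inconclusive.
   Context: Complex vector lattices. An Archimedean real vector lattice $F$ is square mean closed if $f\boxplus g:=\sup\{(\cos\theta)f+(\sin\theta)g:\theta\in[0,2\pi]\}$ exists in $F$ for all $f,g\in F$. An Archimedean complex vector lattice is a complexification $E=E_\rho\oplus iE_\rho$ of a square mean closed Archimedean real vector lattice $E_\rho$ (its real part), with modulus $|f+ig|:=f\boxplus g$ for $f,g\in E_\rho$. Its positive cone is $E_+=\{f\in E:|f|=f\}$, which is also the positive cone of $E_\rho$; order relations, suprema and infima are taken in $E_\rho$. $E$ is universally complete if $E_\rho$ is, i.e. $E_\rho$ is Dedekind complete and every set of pairwise disjoint positive elements has a supremum (such $E_\rho$ is automatically square mean closed). Multiplication. Every universally complete Archimedean real vector lattice is a $\Phi$-algebra, i.e. an $f$-algebra with a multiplicative identity.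 The multiplication of $E_\rho$ is extended canonically (complex bilinearly) to $E$, written by juxtaposition, and $e$ denotes the multiplicative identity. For $a\in E_+$ and $n\in\mathbb{N}=\{1,2,\dots\}$, $a^{1/n}$ denotes the unique $r\in E_+$ with $r^n=a$. The relation $\ll$. A weak order unit in a real vector lattice is a positive element $u$ such that $u\wedge|x|=0$ implies $x=0$. For $x,y\in E_\rho$, $x\ll y$ means that $(y-x)^+$ is a weak order unit in $E_\rho$; $x\not\ll y$ means that this fails. Convergence. A sequence $(x_n)_{n\ge 0}$ in $E$ converges in order to $x\in E$ (written $x_n\to x$) if there is a decreasing sequence $(p_n)_{n\geq 0}$ in $E_+$ with $\inf_n p_n=0$ (written $p_n\downarrow 0$) and $|x_n-x|\le p_n$ for all $n$. A series $\sum_{n=0}^\infty a_n$ in $E$ (with $a_n\in E$ for all $n\ge 0$) converges in order if its sequence of partial sums converges in order to an element of $E$; it converges absolutely in order if $\sum_{n=0}^\infty|a_n|$ converges in order. For an order bounded sequence $(x_n)$ in $E_\rho$, $\limsup_{n\to\infty}x_n:=\inf_{n}\sup_{m\ge n}x_m$. *)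

theory Defs
  imports Complex_Main "HOL-Library.Lattice_Algebras"
begin

section \<open>Real vector lattices and \<open>\<Phi>\<close>-algebras\<close>

text \<open>
  The class \<^class>\<open>lattice_ab_group_add_abs\<close> supplies \<open>\<bar>x\<bar> = sup x (- x)\<close> and the
  positive part \<open>pprt x = sup x 0\<close>.
\<close>

class vector_lattice = ordered_real_vector + lattice_ab_group_add_abs

text \<open>
  Dedekind completeness is \<^class>\<open>conditionally_complete_lattice\<close>; it implies the Archimedean
  property (\<open>archimedean_vector_lattice\<close> below). The empty set has to be excluded in the lateral
  completeness axiom, as a nonzero vector lattice has no least element.
\<close>

class universally_complete_vector_lattice = vector_lattice + conditionally_complete_lattice +
  assumes laterally_complete:
    "D \<noteq> {} \<Longrightarrow> (\<forall>x\<in>D. 0 \<le> x) \<Longrightarrow> (\<forall>x\<in>D. \<forall>y\<in>D. x \<noteq> y \<longrightarrow> inf x y = 0)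
      \<Longrightarrow> \<exists>s. (\<forall>x\<in>D. x \<le> s) \<and> (\<forall>u. (\<forall>x\<in>D. x \<le> u) \<longrightarrow> s \<le> u)"

text \<open>
  An \<open>f\<close>-algebra with multiplicative identity. We use \<^class>\<open>real_algebra\<close> with
  \<^class>\<open>monoid_mult\<close> rather than \<open>real_algebra_1\<close>, because the latter demands
  \<open>0 \<noteq> 1\<close> and thereby excludes the zero space.
\<close>

class phi_algebra = vector_lattice + real_algebra + monoid_mult +
  assumes mult_positive: "0 \<le> a \<Longrightarrow> 0 \<le> b \<Longrightarrow> 0 \<le> a * b"
    and mult_left_disjoint: "inf a b = 0 \<Longrightarrow> 0 \<le> c \<Longrightarrow> inf (c * a) b = 0"
    and mult_right_disjoint: "inf a b = 0 \<Longrightarrow> 0 \<le> c \<Longrightarrow> inf (a * c) b = 0"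

definition weak_order_unit :: "'a::vector_lattice \<Rightarrow> bool" where
  "weak_order_unit u \<longleftrightarrow> 0 \<le> u \<and> (\<forall>x. inf u \<bar>x\<bar> = 0 \<longrightarrow> x = 0)"

definition strongly_below :: "'a::vector_lattice \<Rightarrow> 'a \<Rightarrow> bool"  (infix "\<lless>" 50) where
  "x \<lless> y \<longleftrightarrow> weak_order_unit (pprt (y - x))"

lemma archimedean_vector_lattice:
  fixes x y :: "'a::universally_complete_vector_lattice"
  assumes "\<And>n::nat. of_nat n *\<^sub>R x \<le> y"
  shows "x \<le> 0"
proof -
  let ?S = "range (\<lambda>n::nat. of_nat n *\<^sub>R x)"
  have bdd: "bdd_above ?S"
    using assms by (auto intro!: bdd_aboveI)
  have "of_nat n *\<^sub>R x \<le> Sup ?S - x" for n :: nat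
  proof -
    have "of_nat (Suc n) *\<^sub>R x \<le> Sup ?S"
      by (rule cSup_upper[OF rangeI bdd])
    then show ?thesis
      by (simp add: algebra_simps)
  qed
  then have "Sup ?S \<le> Sup ?S - x"
    by (intro cSup_least) auto
  then show ?thesis
    by (simp add: algebra_simps)
qed


section \<open>Complexification\<close>

text \<open>\<open>Cplx f g\<close> stands for \<open>f + i g\<close>.\<close>

datatype 'a complexification = Cplx (re_part: 'a) (im_part: 'a)

instantiation complexification :: (ab_group_add) ab_group_add
begin

definition "0 = Cplx 0 0"
definition "x + y = Cplx (re_part x + re_part y) (im_part x + im_part y)"
definition "- x = Cplx (- re_part x) (- im_part x)"
definition "x - y = Cplx (re_part x - re_part y) (im_part x - im_part y)"

instance
  by standard (simp_all add: zero_complexification_def plus_complexification_def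
      uminus_complexification_def minus_complexification_def add_ac)

end

instantiation complexification :: ("{ring, monoid_mult}") "{ring, monoid_mult}"
begin

definition "1 = Cplx 1 0"
definition "x * y = Cplx (re_part x * re_part y - im_part x * im_part y)
  (re_part x * im_part y + im_part x * re_part y)"

instance
  by standard (simp_all add: one_complexification_def times_complexification_def
      plus_complexification_def algebra_simps)

end

definition scaleC :: "complex \<Rightarrow> 'a::real_vector complexification \<Rightarrow> 'a complexification" where
  "scaleC c x = Cplx (Re c *\<^sub>R re_part x - Im c *\<^sub>R im_part x)
    (Re c *\<^sub>R im_part x + Im c *\<^sub>R re_part x)"

lemma vector_space_scaleC:
  "vector_space (scaleC :: complex \<Rightarrow> 'a::real_vector complexification \<Rightarrow> _)"
  by unfold_locales
    (simp_all add: scaleC_def plus_complexification_def algebra_simps)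

lemma scaleC_mult:
  fixes x y :: "'a::{real_algebra, monoid_mult} complexification"
  shows "scaleC c x * y = scaleC c (x * y)" "x * scaleC c y = scaleC c (x * y)"
  by (simp_all add: scaleC_def times_complexification_def algebra_simps)

text \<open>
  The modulus of \<open>f + i g\<close> is \<open>sup {(cos \<theta>) f + (sin \<theta>) g : \<theta> \<in> [0, 2 \<pi>]}\<close>; the supremum exists
  in a Dedekind complete vector lattice by \<open>bdd_above_square_mean\<close>. It lies in the real part,
  and is therefore given the type \<^typ>\<open>'a\<close>.
\<close>

definition modulus :: "'a::universally_complete_vector_lattice complexification \<Rightarrow> 'a" where
  "modulus x = (SUP \<theta>\<in>{0..2 * pi}. cos \<theta> *\<^sub>R re_part x + sin \<theta> *\<^sub>R im_part x)"

lemma scaleR_le_abs: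
  fixes f :: "'a::vector_lattice"
  assumes "\<bar>c\<bar> \<le> 1"
  shows "c *\<^sub>R f \<le> \<bar>f\<bar>"
proof -
  have "c *\<^sub>R f \<le> \<bar>c\<bar> *\<^sub>R \<bar>f\<bar>"
  proof (cases "0 \<le> c")
    case True
    then show ?thesis by (simp add: scaleR_left_mono abs_ge_self)
  next
    case False
    then have "(- c) *\<^sub>R (- f) \<le> (- c) *\<^sub>R \<bar>f\<bar>"
      by (intro scaleR_left_mono) (simp_all add: abs_ge_minus_self)
    with False show ?thesis by simp
  qed
  also have "\<dots> \<le> 1 *\<^sub>R \<bar>f\<bar>"
    by (rule scaleR_right_mono) (use assms in simp_all)
  finally show ?thesis by simp
qed

lemma bdd_above_square_mean:
  fixes f g :: "'a::vector_lattice"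
  shows "bdd_above ((\<lambda>\<theta>. cos \<theta> *\<^sub>R f + sin \<theta> *\<^sub>R g) ` {0..2 * pi})"
  by (rule bdd_aboveI[where M = "\<bar>f\<bar> + \<bar>g\<bar>"])
    (auto intro!: add_mono scaleR_le_abs abs_cos_le_one abs_sin_le_one)

lemma modulus_real: "modulus (Cplx f 0) = \<bar>f\<bar>"
proof (rule antisym)
  show "modulus (Cplx f 0) \<le> \<bar>f\<bar>"
    unfolding modulus_def by (rule cSUP_least) (auto intro!: scaleR_le_abs)
  have "f \<le> modulus (Cplx f 0)"
    unfolding modulus_def
    by (rule cSUP_upper2[where x = 0]) (use bdd_above_square_mean[of f 0] in auto)
  moreover have "- f \<le> modulus (Cplx f 0)"
    unfolding modulus_def
    by (rule cSUP_upper2[where x = pi]) (use bdd_above_square_mean[of f 0] in auto)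
  ultimately show "\<bar>f\<bar> \<le> modulus (Cplx f 0)"
    by (simp add: abs_lattice)
qed


section \<open>Order convergence\<close>

definition order_converges_to ::
    "(nat \<Rightarrow> 'a::universally_complete_vector_lattice complexification) \<Rightarrow> 'a complexification \<Rightarrow> bool"
  where
  "order_converges_to x l \<longleftrightarrow>
    (\<exists>p. decseq p \<and> (\<forall>n. 0 \<le> p n) \<and> (INF n. p n) = 0 \<and> (\<forall>n. modulus (x n - l) \<le> p n))"

definition series_order_converges ::
    "(nat \<Rightarrow> 'a::universally_complete_vector_lattice complexification) \<Rightarrow> bool" where
  "series_order_converges a \<longleftrightarrow> (\<exists>s. order_converges_to (\<lambda>N. \<Sum>n\<le>N. a n) s)"

definition series_absolutely_order_converges ::
    "(nat \<Rightarrow> 'a::universally_complete_vector_lattice complexification) \<Rightarrow> bool" where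
  "series_absolutely_order_converges a \<longleftrightarrow>
    series_order_converges (\<lambda>n. Cplx (modulus (a n)) 0)"


section \<open>The root sequence and its limit superior\<close>

text \<open>The unique positive \<open>n\<close>-th root of a positive element, for \<open>n \<ge> 1\<close>.\<close>

definition positive_root :: "nat \<Rightarrow> 'a::phi_algebra \<Rightarrow> 'a" where
  "positive_root n a = (THE r. 0 \<le> r \<and> r ^ n = a)"

definition root_sequence ::
    "(nat \<Rightarrow> 'a::{universally_complete_vector_lattice, phi_algebra} complexification) \<Rightarrow> nat \<Rightarrow> 'a"
  where "root_sequence a n = positive_root n (modulus (a n))"

text \<open>
  The root sequence is indexed by \<open>n \<ge> 1\<close>, hence the restriction to \<open>{1..}\<close> in the next two
  definitions.
\<close>

definition order_bounded_sequence :: "(nat \<Rightarrow> 'a::lattice) \<Rightarrow> bool" where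
  "order_bounded_sequence x \<longleftrightarrow> bdd_below (x ` {1..}) \<and> bdd_above (x ` {1..})"

definition order_limsup :: "(nat \<Rightarrow> 'a::conditionally_complete_lattice) \<Rightarrow> 'a" where
  "order_limsup x = (INF n\<in>{1..}. SUP m\<in>{n..}. x m)"

end

theory Submission
  imports Defs "HOL-Analysis.Summation_Tests"
begin

text \<open>
  The scalar root test compares a series with a geometric one. Here the comparison is carried out
  band by band, and three facts on unital \<open>f\<close>-algebras support it.

  First, roots. A positive element has exactly one positive \<open>n\<close>-th root
  (\<open>positive_root_exists\<close>, \<open>positive_root_unique\<close>). It is the supremum of all \<open>x\<close> whose \<open>n\<close>-th
  power is at most the given element; that the supremum has the right power rests on a Lipschitz
  estimate for powers (\<open>power_diff_le\<close>) and on order continuity of multiplication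
  (\<open>inf_zero_mult_left\<close>, \<open>inf_zero_mult_right\<close>). Bernoulli's inequality (\<open>bernoulli\<close>) bounds
  an element by its powers.

  Second, local boundedness (\<open>locally_bounded_imp_bounded\<close>). If a sequence is bounded on each of
  countably many bands that exhaust the space, then it is bounded: lateral completeness glues the
  local bounds together once the bands have been made disjoint.

  Third, a bounded series of positive elements converges in order, by Dedekind completeness.

  Now let \<open>r n\<close> be the roots and \<open>L\<close> their limit superior. If \<open>L \<lless> 1\<close>, then on the band where
  the roots beyond \<open>j\<close> stay below \<open>1 - 1 / (j + 1)\<close> the series of moduli is dominated by
  a geometric series, apart from finitely many terms. These bands exhaust the space, so the partial
  sums are bounded and the series converges absolutely. Conversely, the terms of an order
  convergent series have a common bound \<open>B\<close>, hence \<open>r n \<le> 1 + B / n\<close> and \<open>L \<le> 1\<close>. Finally, if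
  \<open>L \<le> 1\<close> but not \<open>L \<lless> 1\<close>, the series of the \<open>L ^ n / n\<^sup>2\<close> and of the \<open>L ^ n\<close> both have
  root limit superior \<open>L\<close>. The first is dominated by a scalar series, whereas \<open>L\<close> acts as the
  identity on some nonzero element, so the second is unbounded.
\<close>


section \<open>Disjointness, squares and powers in a \<open>\<Phi>\<close>-algebra\<close>

lemma disjoint_nonneg:
  fixes a b :: "'a::vector_lattice"
  assumes "inf a b = 0"
  shows "0 \<le> a" "0 \<le> b"
  using assms inf_le1[of a b] inf_le2[of a b] by simp_all

lemma disjoint_sup_diff:
  fixes x y :: "'a::vector_lattice"
  shows "inf (sup x y - x) (sup x y - y) = 0"
proof -
  have "inf (sup x y - x) (sup x y - y) = sup x y + inf (- x) (- y)"
    by (simp only: diff_conv_add_uminus add_inf_distrib_left)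
  also have "\<dots> = 0"
    by (metis neg_sup_eq_inf add.right_inverse)
  finally show ?thesis .
qed

lemma disjoint_add:
  fixes a b v :: "'a::vector_lattice"
  assumes a: "inf a v = 0" and b: "inf b v = 0"
  shows "inf (a + b) v = 0"
proof (rule antisym)
  let ?w = "inf (a + b) v"
  have "?w - b \<le> a" by (simp add: algebra_simps)
  moreover have "?w - b \<le> v"
    using disjoint_nonneg[OF b] by (metis diff_left_mono diff_zero inf.cobounded2 order_trans)
  ultimately have "?w - b \<le> inf a v" by (rule le_infI)
  then have "?w \<le> inf b v" using a by (intro le_infI) auto
  with b show "?w \<le> 0" by simp
  show "0 \<le> ?w"
    using disjoint_nonneg[OF a] disjoint_nonneg[OF b] by simp
qed

lemma disjoint_mono:
  fixes a b :: "'a::vector_lattice"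
  assumes "inf a b = 0" "0 \<le> x" "x \<le> a" "0 \<le> y" "y \<le> b"
  shows "inf x y = 0"
  using assms by (metis antisym inf_greatest inf_mono)

instance phi_algebra \<subseteq> ordered_ring
proof
  fix a b c :: 'a
  assume ab: "a \<le> b" and c: "0 \<le> c"
  show "c * a \<le> c * b"
    using mult_positive[OF c, of "b - a"] ab by (simp add: algebra_simps)
  show "a * c \<le> b * c"
    using mult_positive[OF _ c, of "b - a"] ab by (simp add: algebra_simps)
qed

text \<open>
  Multiplying one of two disjoint elements by a positive factor preserves disjointness. Doing so
  on both sides makes \<open>a * b\<close> disjoint from itself.
\<close>

lemma disjoint_mult_zero:
  fixes a b :: "'a::phi_algebra"
  assumes d: "inf a b = 0"
  shows "a * b = 0"
proof -
  note nn = disjoint_nonneg[OF d]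
  have "inf (a * b) b = 0"
    by (rule mult_right_disjoint[OF d nn(2)])
  then have "inf b (a * b) = 0" by (simp add: inf_commute)
  then have "inf (a * b) (a * b) = 0"
    by (rule mult_left_disjoint[OF _ nn(1)])
  then show ?thesis by simp
qed

lemma disjoint_pprt:
  fixes u :: "'a::vector_lattice"
  shows "inf (pprt u) (pprt u - u) = 0"
  using disjoint_sup_diff[of 0 u] by (simp add: pprt_def sup_commute)

lemma mult_pprt:
  fixes u :: "'a::phi_algebra"
  shows "pprt u * u = pprt u * pprt u" "u * pprt u = pprt u * pprt u"
proof -
  have "pprt u * (pprt u - u) = 0" "(pprt u - u) * pprt u = 0"
    using disjoint_pprt[of u] by (auto intro!: disjoint_mult_zero simp: inf_commute)
  then show "pprt u * u = pprt u * pprt u" "u * pprt u = pprt u * pprt u"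
    by (simp_all add: algebra_simps)
qed

text \<open>
  The positive and negative parts of \<open>u\<close> annihilate each other, so no mixed terms occur in
  the square.
\<close>

lemma square_nonneg:
  fixes u :: "'a::phi_algebra"
  shows "0 \<le> u * u"
proof -
  have "u * u = pprt u * pprt u + (pprt u - u) * (pprt u - u)"
    using mult_pprt[of u] by (simp add: algebra_simps)
  moreover have "u \<le> pprt u" "0 \<le> pprt u" by (simp_all add: pprt_def)
  ultimately show ?thesis by (simp add: mult_positive)
qed

lemma one_nonneg: "0 \<le> (1 :: 'a::phi_algebra)"
  using square_nonneg[of "1 :: 'a"] by simp

lemma power_nonneg:
  fixes r :: "'a::phi_algebra"
  assumes "0 \<le> r"
  shows "0 \<le> r ^ n"
  by (induction n) (simp_all add: one_nonneg assms mult_positive)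

lemma power_mono_nonneg:
  fixes x y :: "'a::phi_algebra"
  assumes "0 \<le> x" "x \<le> y"
  shows "x ^ n \<le> y ^ n"
proof (induction n)
  case (Suc n)
  then show ?case
    using assms order_trans[OF assms] by (simp add: mult_mono power_nonneg)
qed simp

lemma one_le_power_of_one_le:
  fixes C :: "'a::phi_algebra"
  assumes "1 \<le> C"
  shows "1 \<le> C ^ n"
proof (induction n)
  case (Suc n)
  then have "1 * 1 \<le> C * C ^ n"
    using assms one_nonneg order_trans[OF one_nonneg assms] by (intro mult_mono) auto
  then show ?case by simp
qed simp

text \<open>
  Bernoulli's inequality. The two sides of the induction step differ by \<open>n (r - 1)\<^sup>2\<close>, which is
  positive as a square. The inequality bounds \<open>r\<close> in terms of \<open>r ^ n\<close>, and all estimates of roots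
  come from it.
\<close>

lemma bernoulli:
  fixes r :: "'a::phi_algebra"
  assumes "0 \<le> r"
  shows "1 + real n *\<^sub>R (r - 1) \<le> r ^ n"
proof (induction n)
  case (Suc n)
  have "1 + real (Suc n) *\<^sub>R (r - 1)
      \<le> 1 + real (Suc n) *\<^sub>R (r - 1) + real n *\<^sub>R ((r - 1) * (r - 1))"
    by (simp add: scaleR_nonneg_nonneg square_nonneg)
  also have "\<dots> = r * (1 + real n *\<^sub>R (r - 1))"
    by (simp add: algebra_simps)
  also have "\<dots> \<le> r * r ^ n"
    using Suc assms by (rule mult_left_mono)
  finally show ?case by simp
qed simp

text \<open>
  A Lipschitz estimate for powers. The difference telescopes into \<open>n + 1\<close> terms
  \<open>y ^ i * (y - x) * x ^ (n - i)\<close>, and in each of them the factors to the left and to the right of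
  \<open>y - x\<close> are at most \<open>C ^ n\<close>.
\<close>

lemma power_diff_le:
  fixes x y C :: "'a::phi_algebra"
  assumes "0 \<le> x" "x \<le> y" "y \<le> C" "1 \<le> C"
  shows "y ^ Suc n - x ^ Suc n \<le> real (Suc n) *\<^sub>R (C ^ n * (y - x) * C ^ n)"
proof (induction n)
  case (Suc n)
  have C0: "0 \<le> C" using assms one_nonneg order_trans by blast
  have y0: "0 \<le> y" using assms by auto
  let ?D = "C ^ n * (y - x) * C ^ n"
  let ?E = "C ^ Suc n * (y - x) * C ^ Suc n"
  have D0: "0 \<le> ?D" using assms C0 by (simp add: mult_positive power_nonneg)
  have CD: "C * ?D \<le> ?E"
  proof -
    have "C ^ n * 1 \<le> C ^ n * C"
      by (rule mult_left_mono) (use assms C0 power_nonneg in auto)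
    then have "C ^ n \<le> C ^ Suc n" by (simp add: power_commutes)
    then have "C ^ Suc n * (y - x) * C ^ n \<le> ?E"
      by (rule mult_left_mono) (use assms C0 power_nonneg mult_positive in \<open>auto intro!: mult_positive\<close>)
    then show ?thesis by (simp add: mult.assoc)
  qed
  have "y ^ Suc (Suc n) - x ^ Suc (Suc n)
      = y * (y ^ Suc n - x ^ Suc n) + (y - x) * x ^ Suc n"
    by (simp add: algebra_simps)
  also have "\<dots> \<le> real (Suc n) *\<^sub>R ?E + ?E"
  proof (rule add_mono)
    have "y * (y ^ Suc n - x ^ Suc n) \<le> y * (real (Suc n) *\<^sub>R ?D)"
      using Suc y0 by (rule mult_left_mono)
    also have "\<dots> \<le> C * (real (Suc n) *\<^sub>R ?D)"
      using assms D0 by (intro mult_right_mono scaleR_nonneg_nonneg) auto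
    also have "\<dots> = real (Suc n) *\<^sub>R (C * ?D)" by (simp only: mult_scaleR_right)
    also have "\<dots> \<le> real (Suc n) *\<^sub>R ?E"
      using CD by (intro scaleR_left_mono) auto
    finally show "y * (y ^ Suc n - x ^ Suc n) \<le> real (Suc n) *\<^sub>R ?E" .
    have "1 * ((y - x) * x ^ Suc n) \<le> C ^ Suc n * ((y - x) * C ^ Suc n)"
      using assms C0 y0 power_mono_nonneg[of x C "Suc n"] one_le_power_of_one_le[of C "Suc n"]
      by (intro mult_mono mult_positive power_nonneg) auto
    then show "(y - x) * x ^ Suc n \<le> ?E" by (simp only: mult.assoc mult_1_left)
  qed
  also have "\<dots> = real (Suc (Suc n)) *\<^sub>R ?E"
    by (simp only: of_nat_Suc[of "Suc n"] scaleR_add_left scaleR_one add.commute)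
  finally show ?case .
qed simp

lemma power_add_le:
  fixes y p :: "'a::phi_algebra"
  assumes "0 \<le> y" "0 \<le> p"
  shows "y ^ Suc n + p ^ Suc n \<le> (y + p) ^ Suc n"
proof (induction n)
  case (Suc n)
  have "y ^ Suc (Suc n) + p ^ Suc (Suc n) \<le>
     y * y ^ Suc n + p * p ^ Suc n + (y * p ^ Suc n + p * y ^ Suc n)"
    using assms by (simp add: mult_positive power_nonneg)
  also have "\<dots> = (y + p) * (y ^ Suc n + p ^ Suc n)"
    by (simp add: algebra_simps)
  also have "\<dots> \<le> (y + p) * (y + p) ^ Suc n"
    using Suc assms by (intro mult_left_mono) auto
  finally show ?case by simp
qed simp

text \<open>
  In the recursion \<open>d ^ Suc n - x ^ Suc n = d * (d ^ n - x ^ n) + (d - x) * x ^ n\<close> both summands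
  are disjoint from \<open>v\<close>. Used twice with \<open>d = sup x y\<close>, this carries the disjointness of \<open>d - x\<close> and
  \<open>d - y\<close> over to powers.
\<close>

lemma power_diff_disjoint:
  fixes x d v :: "'a::phi_algebra"
  assumes "0 \<le> x" "x \<le> d" "inf (d - x) v = 0"
  shows "inf (d ^ n - x ^ n) v = 0"
proof (induction n)
  case 0
  show ?case using disjoint_nonneg[OF assms(3)] by (simp add: inf_absorb1)
next
  case (Suc n)
  have "inf (d * (d ^ n - x ^ n)) v = 0"
    using Suc assms by (intro mult_left_disjoint) auto
  moreover have "inf ((d - x) * x ^ n) v = 0"
    using assms by (intro mult_right_disjoint power_nonneg)
  ultimately have "inf (d * (d ^ n - x ^ n) + (d - x) * x ^ n) v = 0"
    by (rule disjoint_add)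
  then show ?case by (simp add: algebra_simps)
qed

section \<open>Consequences of the Archimedean property\<close>

lemma archimedean_scaled:
  fixes x y :: "'a::universally_complete_vector_lattice"
  assumes "\<And>n. n \<ge> 1 \<Longrightarrow> real n *\<^sub>R x \<le> y"
  shows "x \<le> 0"
proof (rule archimedean_vector_lattice)
  fix n :: nat
  have "real n *\<^sub>R x + x = real (Suc n) *\<^sub>R x" by (simp add: algebra_simps)
  also have "\<dots> \<le> y" using assms[of "Suc n"] by simp
  finally show "real n *\<^sub>R x \<le> y - x" by (simp add: algebra_simps)
qed

text \<open>
  If a power of \<open>p\<close> vanishes, then so does that power of every multiple \<open>k p\<close>, and Bernoulli's
  inequality gives \<open>k p \<le> 1\<close> for all \<open>k\<close>.
\<close>

lemma nilpotent_eq_zero: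
  fixes p :: "'a::{universally_complete_vector_lattice, phi_algebra}"
  assumes p: "0 \<le> p" and z: "p ^ Suc n = 0"
  shows "p = 0"
proof (rule antisym)
  show "p \<le> 0"
  proof (rule archimedean_scaled)
    fix k :: nat
    assume "k \<ge> 1"
    have "1 + real (Suc n) *\<^sub>R (real k *\<^sub>R p - 1) \<le> (real k *\<^sub>R p) ^ Suc n"
      using p by (intro bernoulli scaleR_nonneg_nonneg) auto
    also have "\<dots> = 0"
    proof -
      have "(real k *\<^sub>R p) ^ m = real k ^ m *\<^sub>R p ^ m" for m
        by (induction m) (simp_all add: algebra_simps)
      then show ?thesis using z by simp
    qed
    finally have "1 + real (Suc n) *\<^sub>R (real k *\<^sub>R p - 1) \<le> 0" .
    then have "real (Suc n) *\<^sub>R (real k *\<^sub>R p - 1) \<le> 0"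
      using one_nonneg[where 'a='a] by (metis add_increasing order_trans order_refl)
    then have "inverse (real (Suc n)) *\<^sub>R real (Suc n) *\<^sub>R (real k *\<^sub>R p - 1) \<le> inverse (real (Suc n)) *\<^sub>R 0"
      by (intro scaleR_left_mono) auto
    then show "real k *\<^sub>R p \<le> 1" by simp
  qed
qed (rule p)

text \<open>
  For \<open>d = sup x y\<close> the elements \<open>d ^ Suc n - x ^ Suc n\<close> and \<open>d ^ Suc n - y ^ Suc n\<close> are disjoint;
  as they coincide, both vanish. Then \<open>y + (d - y)\<close> and \<open>y\<close> have the same power, which makes
  \<open>d - y\<close> nilpotent.
\<close>

lemma le_of_power_eq:
  fixes x y :: "'a::{universally_complete_vector_lattice, phi_algebra}"
  assumes x: "0 \<le> x" and y: "0 \<le> y" and eq: "x ^ Suc n = y ^ Suc n"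
  shows "x \<le> y"
proof -
  let ?d = "sup x y"
  have d: "x \<le> ?d" "y \<le> ?d" by simp_all
  have "inf (?d ^ Suc n - x ^ Suc n) (?d - y) = 0"
    by (rule power_diff_disjoint[OF x d(1) disjoint_sup_diff])
  then have "inf (?d ^ Suc n - y ^ Suc n) (?d ^ Suc n - x ^ Suc n) = 0"
    by (intro power_diff_disjoint[OF y d(2)]) (simp add: inf_commute)
  then have dy: "?d ^ Suc n = y ^ Suc n" using eq by simp
  have "y ^ Suc n + (?d - y) ^ Suc n \<le> (y + (?d - y)) ^ Suc n"
    using y d by (intro power_add_le) auto
  then have "(?d - y) ^ Suc n \<le> 0" using dy by simp
  moreover have "0 \<le> (?d - y) ^ Suc n" using d by (intro power_nonneg) auto
  ultimately have "(?d - y) ^ Suc n = 0" by (rule antisym)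
  then have "?d - y = 0" by (rule nilpotent_eq_zero[rotated]) (use d in simp)
  then have "?d = y" by simp
  with d(1) show ?thesis by simp
qed


lemma archimedean_bound:
  fixes x y K :: "'a::universally_complete_vector_lattice"
  assumes "\<And>n. n \<ge> 1 \<Longrightarrow> x \<le> y + inverse (real n) *\<^sub>R K"
  shows "x \<le> y"
proof -
  have "x - y \<le> 0"
  proof (rule archimedean_scaled)
    fix n :: nat
    assume n: "n \<ge> 1"
    have "real n *\<^sub>R (x - y) \<le> real n *\<^sub>R (inverse (real n) *\<^sub>R K)"
      using assms[OF n] by (intro scaleR_left_mono) (simp_all add: algebra_simps)
    with n show "real n *\<^sub>R (x - y) \<le> K" by simp
  qed
  then show ?thesis by simp
qed

text \<open>
  The inequality of arithmetic and geometric means, from the square of \<open>C - m\<close>. It replaces an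
  unbounded factor \<open>C\<close> by a scalar, up to an error that tends to zero as \<open>m\<close> grows.
\<close>

lemma le_scalar_plus_square:
  fixes C :: "'a::phi_algebra"
  assumes m: "m \<ge> 1" and C: "0 \<le> C"
  shows "C \<le> real m *\<^sub>R 1 + inverse (real m) *\<^sub>R (C * C)"
proof -
  have "0 \<le> (C - real m *\<^sub>R 1) * (C - real m *\<^sub>R 1)" by (rule square_nonneg)
  also have "\<dots> = C * C + (real m * real m) *\<^sub>R 1 - real m *\<^sub>R C - real m *\<^sub>R C"
    by (simp add: algebra_simps)
  finally have "real m *\<^sub>R C + real m *\<^sub>R C \<le> C * C + (real m * real m) *\<^sub>R 1"
    by (simp add: algebra_simps)
  moreover have "0 \<le> real m *\<^sub>R C" using C by (simp add: scaleR_nonneg_nonneg)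
  ultimately have "real m *\<^sub>R C \<le> C * C + (real m * real m) *\<^sub>R 1"
    by (metis add_increasing order_trans order_refl)
  then have "inverse (real m) *\<^sub>R real m *\<^sub>R C
      \<le> inverse (real m) *\<^sub>R (C * C + (real m * real m) *\<^sub>R 1)"
    by (intro scaleR_left_mono) auto
  moreover have "inverse (real m) * (real m * real m) = real m" using m by simp
  ultimately show ?thesis using m by (simp add: scaleR_add_right add.commute)
qed

text \<open>
  For fixed \<open>m\<close> the bounds \<open>w \<le> T i \<le> m z i + K / m\<close> make \<open>(w - K / m) / m\<close> a lower bound of
  the \<open>z i\<close>, so \<open>w \<le> K / m\<close>. Together with \<open>le_scalar_plus_square\<close> this yields order
  continuity of multiplication.
\<close>

lemma inf_zero_transfer:
  fixes z T :: "'i \<Rightarrow> 'a::universally_complete_vector_lattice"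
  assumes T: "\<And>m i. m \<ge> 1 \<Longrightarrow> i \<in> I \<Longrightarrow> T i \<le> real m *\<^sub>R z i + inverse (real m) *\<^sub>R K"
    and z: "\<And>v. (\<And>i. i \<in> I \<Longrightarrow> v \<le> z i) \<Longrightarrow> v \<le> 0"
    and w: "\<And>i. i \<in> I \<Longrightarrow> w \<le> T i"
  shows "w \<le> 0"
proof (rule archimedean_bound)
  fix m :: nat
  assume m: "m \<ge> 1"
  let ?v = "inverse (real m) *\<^sub>R (w - inverse (real m) *\<^sub>R K)"
  have "?v \<le> z i" if i: "i \<in> I" for i
  proof -
    have "w \<le> real m *\<^sub>R z i + inverse (real m) *\<^sub>R K"
      using w[OF i] T[OF m i] by (rule order_trans)
    then have "?v \<le> inverse (real m) *\<^sub>R real m *\<^sub>R z i"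
      by (intro scaleR_left_mono) (simp_all add: algebra_simps)
    with m show ?thesis by simp
  qed
  then have "?v \<le> 0" by (rule z)
  then have "real m *\<^sub>R ?v \<le> real m *\<^sub>R 0"
    by (intro scaleR_left_mono) auto
  with m show "w \<le> 0 + inverse (real m) *\<^sub>R K" by simp
qed

lemma inf_zero_mult_left:
  fixes C b :: "'a::{universally_complete_vector_lattice, phi_algebra}"
  assumes C: "0 \<le> C" and zb: "\<And>i. i \<in> I \<Longrightarrow> 0 \<le> z i \<and> z i \<le> b"
    and z: "\<And>v. (\<And>i. i \<in> I \<Longrightarrow> v \<le> z i) \<Longrightarrow> v \<le> 0"
    and w: "\<And>i. i \<in> I \<Longrightarrow> w \<le> C * z i"
  shows "w \<le> 0"
proof (rule inf_zero_transfer[of I "\<lambda>i. C * z i" z "C * C * b"])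
  fix m :: nat and i
  assume m: "m \<ge> 1" and i: "i \<in> I"
  have "C * z i \<le> (real m *\<^sub>R 1 + inverse (real m) *\<^sub>R (C * C)) * z i"
    using zb[OF i] by (intro mult_right_mono le_scalar_plus_square m C) auto
  also have "\<dots> = real m *\<^sub>R z i + inverse (real m) *\<^sub>R (C * C * z i)"
    by (simp add: distrib_right)
  also have "\<dots> \<le> real m *\<^sub>R z i + inverse (real m) *\<^sub>R (C * C * b)"
    using zb[OF i] C by (intro add_left_mono scaleR_left_mono mult_left_mono mult_positive) auto
  finally show "C * z i \<le> real m *\<^sub>R z i + inverse (real m) *\<^sub>R (C * C * b)" .
qed (rule z w; assumption)+

lemma inf_zero_mult_right:
  fixes C b :: "'a::{universally_complete_vector_lattice, phi_algebra}"
  assumes C: "0 \<le> C" and zb: "\<And>i. i \<in> I \<Longrightarrow> 0 \<le> z i \<and> z i \<le> b"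
    and z: "\<And>v. (\<And>i. i \<in> I \<Longrightarrow> v \<le> z i) \<Longrightarrow> v \<le> 0"
    and w: "\<And>i. i \<in> I \<Longrightarrow> w \<le> z i * C"
  shows "w \<le> 0"
proof (rule inf_zero_transfer[of I "\<lambda>i. z i * C" z "b * (C * C)"])
  fix m :: nat and i
  assume m: "m \<ge> 1" and i: "i \<in> I"
  have "z i * C \<le> z i * (real m *\<^sub>R 1 + inverse (real m) *\<^sub>R (C * C))"
    using zb[OF i] by (intro mult_left_mono le_scalar_plus_square m C) auto
  also have "\<dots> = real m *\<^sub>R z i + inverse (real m) *\<^sub>R (z i * (C * C))"
    by (simp add: distrib_left)
  also have "\<dots> \<le> real m *\<^sub>R z i + inverse (real m) *\<^sub>R (b * (C * C))"
    using zb[OF i] C by (intro add_left_mono scaleR_left_mono mult_right_mono mult_positive) auto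
  finally show "z i * C \<le> real m *\<^sub>R z i + inverse (real m) *\<^sub>R (b * (C * C))" .
qed (rule z w; assumption)+

section \<open>Positive roots\<close>

text \<open>
  The element \<open>t\<close> serves as a local inverse of \<open>D\<close>: multiplication by \<open>t\<close> makes \<open>D\<close> bounded by
  a scalar, because \<open>D * t = m (t - t\<^sup>2)\<close>, while \<open>t\<close> tends to the identity as \<open>m\<close> grows.
\<close>

lemma truncated_complement:
  fixes D :: "'a::phi_algebra"
  assumes D: "0 \<le> D" and m: "m \<ge> 1"
  defines "t \<equiv> pprt (1 - inverse (real m) *\<^sub>R D)"
  shows "0 \<le> t" "t \<le> 1" "1 - t \<le> inverse (real m) *\<^sub>R D"
    "D * t \<le> real m *\<^sub>R 1" "t * D \<le> real m *\<^sub>R 1"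
proof -
  let ?u = "1 - inverse (real m) *\<^sub>R D"
  show t0: "0 \<le> t" by (simp add: t_def pprt_def)
  have "0 \<le> inverse (real m) *\<^sub>R D" using D by (simp add: scaleR_nonneg_nonneg)
  then show t1: "t \<le> 1" by (simp add: t_def pprt_def one_nonneg)
  have "?u \<le> t" by (simp add: t_def pprt_def)
  then show "1 - t \<le> inverse (real m) *\<^sub>R D" by (simp add: algebra_simps)
  have D_eq: "D = real m *\<^sub>R (1 - ?u)" using m by simp
  have tt: "real m *\<^sub>R (t - t * t) \<le> real m *\<^sub>R 1"
  proof (intro scaleR_left_mono)
    have "t - t * t \<le> t" using t0 by (simp add: mult_positive)
    then show "t - t * t \<le> 1" using t1 by (rule order_trans)
  qed simp
  have "D * t = real m *\<^sub>R (t - ?u * t)"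
    by (subst D_eq) (simp only: mult_scaleR_left left_diff_distrib mult_1_left)
  also have "\<dots> = real m *\<^sub>R (t - t * t)" using mult_pprt(2)[of ?u] by (simp add: t_def)
  finally show "D * t \<le> real m *\<^sub>R 1" using tt by simp
  have "t * D = real m *\<^sub>R (t - t * ?u)"
    by (subst D_eq) (simp only: mult_scaleR_right right_diff_distrib mult_1_right)
  also have "\<dots> = real m *\<^sub>R (t - t * t)" using mult_pprt(1)[of ?u] by (simp add: t_def)
  finally show "t * D \<le> real m *\<^sub>R 1" using tt by simp
qed

text \<open>
  If \<open>D\<close> were invertible, the increment \<open>\<delta>\<close> with \<open>(k + 1) D \<delta> D = w\<close> would settle the claim. The
  elements \<open>t\<close> of \<open>truncated_complement\<close> take the place of an inverse: suitable multiples of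
  \<open>t * w * t\<close> are admissible increments, so \<open>t * w * t = 0\<close>, and \<open>t * w * t\<close> tends to \<open>w\<close>.
\<close>

lemma no_small_increment:
  fixes D w :: "'a::{universally_complete_vector_lattice, phi_algebra}"
  assumes D: "0 \<le> D" and w: "0 \<le> w"
    and max: "\<And>\<delta>. 0 \<le> \<delta> \<Longrightarrow> real (Suc k) *\<^sub>R (D * \<delta> * D) \<le> w \<Longrightarrow> \<delta> \<le> 0"
  shows "w = 0"
proof (rule antisym)
  show "w \<le> 0"
  proof (rule archimedean_bound)
    fix m :: nat
    assume m: "m \<ge> 1"
    define t where "t = pprt (1 - inverse (real m) *\<^sub>R D)"
    note t = truncated_complement[OF D m, folded t_def]
    \<comment> \<open>\<open>D * t\<close> and \<open>t * D\<close> each contribute a factor \<open>m\<close> to the bound for \<open>D * (t * w * t) * D\<close>.\<close>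
    let ?c = "inverse (real (Suc k) * real m * real m)"
    have twt0: "0 \<le> t * w * t" using t w by (simp add: mult_positive)
    have "?c *\<^sub>R (t * w * t) \<le> 0"
    proof (rule max)
      show "0 \<le> ?c *\<^sub>R (t * w * t)" using twt0 by (intro scaleR_nonneg_nonneg) auto
      have "(D * t) * w * (t * D) \<le> (real m *\<^sub>R 1) * w * (real m *\<^sub>R 1)"
        using t w D one_nonneg[where 'a='a]
        by (intro mult_mono mult_positive scaleR_nonneg_nonneg) auto
      then have "D * (t * w * t) * D \<le> (real m * real m) *\<^sub>R w" by (simp add: mult.assoc)
      then have "(real (Suc k) * ?c) *\<^sub>R (D * (t * w * t) * D) \<le> (real (Suc k) * ?c) *\<^sub>R ((real m * real m) *\<^sub>R w)"
        by (intro scaleR_left_mono) auto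
      also have "\<dots> = w"
      proof -
        have "real (Suc k) * ?c * (real m * real m) = 1" using m by (simp add: field_simps del: of_nat_Suc)
        then show ?thesis by (simp only: scaleR_scaleR scaleR_one)
      qed
      finally show "real (Suc k) *\<^sub>R (D * (?c *\<^sub>R (t * w * t)) * D) \<le> w" by simp
    qed
    then have "inverse ?c *\<^sub>R ?c *\<^sub>R (t * w * t) \<le> inverse ?c *\<^sub>R 0"
      by (intro scaleR_left_mono) auto
    moreover have "inverse ?c * ?c = 1" using m by (intro left_inverse) simp
    ultimately have "t * w * t \<le> 0" by (simp only: scaleR_scaleR scaleR_one scaleR_zero_right)
    have "w = t * w * t + (1 - t) * w + t * w * (1 - t)" by (simp add: algebra_simps)
    also have "\<dots> \<le> 0 + (inverse (real m) *\<^sub>R D) * w + 1 * w * (inverse (real m) *\<^sub>R D)"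
      using t w D \<open>t * w * t \<le> 0\<close> one_nonneg[where 'a='a]
      by (intro add_mono mult_mono mult_positive scaleR_nonneg_nonneg) auto
    finally show "w \<le> 0 + inverse (real m) *\<^sub>R (D * w + w * D)" by (simp add: scaleR_add_right)
  qed
qed (rule w)

lemma le_one_plus_of_power_le:
  fixes x a :: "'a::phi_algebra"
  assumes x: "0 \<le> x" and n: "n \<ge> 1" and le: "x ^ n \<le> a"
  shows "x \<le> 1 + inverse (real n) *\<^sub>R a"
proof -
  have "1 + real n *\<^sub>R (x - 1) \<le> a"
    using bernoulli[OF x] le by (rule order_trans)
  then have "real n *\<^sub>R (x - 1) \<le> a"
    using one_nonneg[where 'a='a] by (metis add_increasing order_trans order_refl)
  then have "inverse (real n) *\<^sub>R real n *\<^sub>R (x - 1) \<le> inverse (real n) *\<^sub>R a"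
    by (intro scaleR_left_mono) auto
  then have "x - 1 \<le> inverse (real n) *\<^sub>R a" using n by simp
  then show ?thesis by (simp only: diff_le_eq add.commute)
qed

text \<open>
  The root is the supremum \<open>r\<close> of all \<open>x\<close> with \<open>x ^ Suc k \<le> a\<close>, a set that Bernoulli's inequality
  bounds. The Lipschitz estimate for powers, combined with order continuity of multiplication,
  gives \<open>r ^ Suc k \<le> a\<close>. If the inequality were strict, the same estimate would leave room for a
  nonzero increment of \<open>r\<close>, contrary to \<open>no_small_increment\<close>.
\<close>

lemma positive_root_exists:
  fixes a :: "'a::{universally_complete_vector_lattice, phi_algebra}"
  assumes a: "0 \<le> a"
  shows "\<exists>r. 0 \<le> r \<and> r ^ Suc k = a"
proof -
  let ?S = "{x. 0 \<le> x \<and> x ^ Suc k \<le> a}"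
  define r where "r = Sup ?S"
  have "x \<le> 1 + a" if "x \<in> ?S" for x
  proof -
    have "x \<le> 1 + inverse (real (Suc k)) *\<^sub>R a"
      using that by (intro le_one_plus_of_power_le) auto
    also have "inverse (real (Suc k)) *\<^sub>R a \<le> 1 *\<^sub>R a"
      using a by (intro scaleR_right_mono) (auto simp: field_simps)
    finally show ?thesis by simp
  qed
  then have bdd: "bdd_above ?S" by (rule bdd_aboveI)
  have zero: "0 \<in> ?S" using a by simp
  have upper: "x \<le> r" if "x \<in> ?S" for x
    unfolding r_def using that bdd by (rule cSup_upper)
  have r0: "0 \<le> r" using upper zero by blast
  \<comment> \<open>\<open>C\<close> is above the identity, above \<open>r\<close>, and above \<open>r + \<delta>\<close> for every increment \<open>\<delta> \<le> a\<close>.\<close>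
  define C where "C = 1 + r + a"
  define D where "D = C ^ k"
  have C: "1 \<le> C" "r \<le> C" "0 \<le> C"
    using r0 a one_nonneg[where 'a='a] by (simp_all add: C_def add_increasing add_increasing2)
  have D1: "1 \<le> D" and D0: "0 \<le> D"
    using C by (auto simp: D_def one_le_power_of_one_le power_nonneg)
  have le: "r ^ Suc k \<le> a"
  proof -
    have inf1: "v \<le> 0" if v: "\<And>x. x \<in> ?S \<Longrightarrow> v \<le> r - x" for v
    proof -
      have "r \<le> r - v"
        using zero v by (subst r_def, intro cSup_least) (auto simp: algebra_simps)
      then show ?thesis by simp
    qed
    have inf2: "v \<le> 0" if v: "\<And>x. x \<in> ?S \<Longrightarrow> v \<le> (r - x) * D" for v
      by (rule inf_zero_mult_right[where I = "?S" and z = "\<lambda>x. r - x" and C = D and b = r])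
        (use D0 upper inf1 v in auto)
    have inf3: "v \<le> 0" if v: "\<And>x. x \<in> ?S \<Longrightarrow> v \<le> D * ((r - x) * D)" for v
    proof (rule inf_zero_mult_left[where I = "?S" and z = "\<lambda>x. (r - x) * D" and C = D and b = "r * D"])
      fix x assume x: "x \<in> ?S"
      then show "0 \<le> (r - x) * D \<and> (r - x) * D \<le> r * D"
        using upper[OF x] D0 by (auto intro!: mult_positive mult_right_mono)
    qed (use D0 inf2 v in auto)
    have "inverse (real (Suc k)) *\<^sub>R (r ^ Suc k - a) \<le> 0"
    proof (rule inf3)
      fix x assume x: "x \<in> ?S"
      then have "r ^ Suc k - a \<le> r ^ Suc k - x ^ Suc k" by auto
      also have "\<dots> \<le> real (Suc k) *\<^sub>R (D * (r - x) * D)"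
        unfolding D_def using x upper[OF x] C by (intro power_diff_le) auto
      finally have "inverse (real (Suc k)) *\<^sub>R (r ^ Suc k - a) \<le> inverse (real (Suc k)) *\<^sub>R real (Suc k) *\<^sub>R (D * (r - x) * D)"
        by (intro scaleR_left_mono) auto
      then show "inverse (real (Suc k)) *\<^sub>R (r ^ Suc k - a) \<le> D * ((r - x) * D)"
        by (simp add: mult.assoc)
    qed
    then have "real (Suc k) *\<^sub>R inverse (real (Suc k)) *\<^sub>R (r ^ Suc k - a) \<le> real (Suc k) *\<^sub>R 0"
      by (intro scaleR_left_mono) auto
    then show ?thesis by simp
  qed
  have "a - r ^ Suc k = 0"
  proof (rule no_small_increment[OF D0])
    fix \<delta> :: 'a
    assume d0: "0 \<le> \<delta>" and dw: "real (Suc k) *\<^sub>R (D * \<delta> * D) \<le> a - r ^ Suc k"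
    have "1 * \<delta> * 1 \<le> D * \<delta> * D"
      using D1 D0 d0 one_nonneg[where 'a='a] by (intro mult_mono mult_positive) auto
    then have "1 *\<^sub>R \<delta> \<le> real (Suc k) *\<^sub>R (D * \<delta> * D)"
      using d0 by (intro scaleR_mono) auto
    also have "\<dots> \<le> a" using dw power_nonneg[OF r0, of "Suc k"]
      by (metis diff_left_mono diff_zero order_trans)
    finally have "\<delta> \<le> a" by simp
    then have "r + \<delta> \<le> C"
      using one_nonneg[where 'a='a] by (simp add: C_def add_increasing add_mono)
    then have "(r + \<delta>) ^ Suc k - r ^ Suc k \<le> real (Suc k) *\<^sub>R (D * ((r + \<delta>) - r) * D)"
      unfolding D_def using r0 d0 C by (intro power_diff_le) auto
    also have "\<dots> \<le> a - r ^ Suc k" using dw by simp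
    finally have "r + \<delta> \<in> ?S" using r0 d0 by simp
    then have "r + \<delta> \<le> r" by (rule upper)
    then show "\<delta> \<le> 0" by simp
  qed (use le in simp)
  with r0 show ?thesis by (intro exI[of _ r]) simp
qed

lemma positive_root_unique:
  fixes r s :: "'a::{universally_complete_vector_lattice, phi_algebra}"
  assumes "0 \<le> r" "0 \<le> s" "r ^ Suc n = s ^ Suc n"
  shows "r = s"
  using le_of_power_eq[of r s n] le_of_power_eq[of s r n] assms by (simp add: antisym)

lemma positive_root_eqI:
  fixes r :: "'a::{universally_complete_vector_lattice, phi_algebra}"
  assumes "n \<ge> 1" "0 \<le> r" "r ^ n = a"
  shows "positive_root n a = r"
proof -
  obtain k where k: "n = Suc k" using assms(1) by (cases n) auto
  show ?thesis
    unfolding positive_root_def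
  proof (rule the_equality)
    fix s assume "0 \<le> s \<and> s ^ n = a"
    then show "s = r" using assms k by (intro positive_root_unique[of s r k]) auto
  qed (use assms in auto)
qed

lemma positive_root_power:
  fixes a :: "'a::{universally_complete_vector_lattice, phi_algebra}"
  assumes n: "n \<ge> 1" and a: "0 \<le> a"
  shows "0 \<le> positive_root n a" "positive_root n a ^ n = a"
proof -
  obtain k where "n = Suc k" using n by (cases n) auto
  then obtain r where r: "0 \<le> r" "r ^ n = a"
    using positive_root_exists[OF a] by blast
  have "positive_root n a = r" by (rule positive_root_eqI[OF n r])
  with r show "0 \<le> positive_root n a" "positive_root n a ^ n = a"
    by simp_all
qed


section \<open>Components of the identity and lateral completeness\<close>

text \<open>
  The component of the identity in the band of all elements disjoint from \<open>q\<close>. Its complement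
  \<open>1 - polar_component q\<close> acts by multiplication as the projection onto the band generated by \<open>q\<close>.
\<close>

definition polar_component :: "'a::{universally_complete_vector_lattice, phi_algebra} \<Rightarrow> 'a" where
  "polar_component q = Sup {x. 0 \<le> x \<and> x \<le> 1 \<and> inf x q = 0}"

lemma polar_component_upper:
  assumes "0 \<le> x" "x \<le> 1" "inf x q = 0"
  shows "x \<le> polar_component q"
  unfolding polar_component_def
  by (rule cSup_upper) (use assms in \<open>auto intro!: bdd_aboveI[of _ 1]\<close>)

lemma polar_component_least:
  assumes "0 \<le> q" "\<And>x. 0 \<le> x \<Longrightarrow> x \<le> 1 \<Longrightarrow> inf x q = 0 \<Longrightarrow> x \<le> u"
  shows "polar_component q \<le> u"
proof -
  have "0 \<in> {x. 0 \<le> x \<and> x \<le> 1 \<and> inf x q = 0}"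
    using assms(1) one_nonneg by (auto simp: inf_absorb1)
  then show ?thesis
    unfolding polar_component_def using assms(2) by (intro cSup_least) auto
qed

lemma polar_component_bounds:
  assumes "0 \<le> q"
  shows "0 \<le> polar_component q" "polar_component q \<le> 1"
  using assms one_nonneg
  by (auto intro!: polar_component_upper polar_component_least simp: inf_absorb1)

lemma polar_component_disjoint:
  assumes q: "0 \<le> q"
  shows "inf (polar_component q) q = 0"
proof (rule antisym)
  let ?e = "polar_component q"
  let ?v = "inf ?e q"
  have v: "0 \<le> ?v" using q polar_component_bounds[OF q] by simp
  \<comment> \<open>\<open>?v\<close> can be added to every element of the set whose supremum is \<open>?e\<close>.\<close>
  have "?e \<le> ?e - ?v"
  proof (rule polar_component_least[OF q])
    fix x :: 'a
    assume x: "0 \<le> x" "x \<le> 1" "inf x q = 0"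
    have "inf x ?v = 0" by (rule disjoint_mono[OF x(3) x(1) order_refl v]) simp
    then have "x + ?v = sup x ?v" by (simp add: add_eq_inf_sup[of x ?v])
    also have "\<dots> \<le> ?e" using polar_component_upper[OF x] by simp
    finally show "x \<le> ?e - ?v" by (simp only: le_diff_eq)
  qed
  then have "?e + ?v \<le> ?e + 0" by (simp only: le_diff_eq add_0_right)
  then show "?v \<le> 0" by (rule add_le_imp_le_left)
  show "0 \<le> ?v" by (rule v)
qed

text \<open>
  The element \<open>inf (2 e) 1\<close> competes in the supremum that defines \<open>e\<close>, so it is at most \<open>e\<close>; and it
  exceeds \<open>e\<close> by exactly \<open>inf e (1 - e)\<close>.
\<close>

lemma polar_component_component:
  assumes q: "0 \<le> q"
  shows "inf (polar_component q) (1 - polar_component q) = 0"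
proof (rule antisym)
  let ?e = "polar_component q"
  note e = polar_component_bounds[OF q]
  have "inf (?e + ?e) q = 0"
    using polar_component_disjoint[OF q] by (intro disjoint_add)
  then have "inf (inf (?e + ?e) 1) q = 0"
    by (rule disjoint_mono) (use e q one_nonneg in auto)
  then have "inf (?e + ?e) 1 \<le> ?e"
    using e one_nonneg by (intro polar_component_upper) auto
  moreover have "inf (?e + ?e) 1 = ?e + inf ?e (1 - ?e)"
    by (simp add: add_inf_distrib_left)
  ultimately show "inf ?e (1 - ?e) \<le> 0" by simp
  show "0 \<le> inf ?e (1 - ?e)" using e by simp
qed

lemma polar_component_complement:
  assumes q: "0 \<le> q" and t: "0 \<le> t" "inf t q = 0"
  shows "inf t (1 - polar_component q) = 0"
proof (rule antisym)
  let ?e = "polar_component q"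
  let ?y = "inf t (1 - ?e)"
  note e = polar_component_bounds[OF q]
  show y0: "0 \<le> ?y" using t e by simp
  have "?y \<le> 1 - ?e" by simp
  also have "1 - ?e \<le> 1" using e by simp
  finally have y1: "?y \<le> 1" .
  have "inf ?y q = 0" by (rule disjoint_mono[OF t(2) y0]) (use q in auto)
  with y0 y1 have "?y \<le> ?e" by (rule polar_component_upper)
  then have "?y \<le> inf ?e (1 - ?e)" by simp
  then show "?y \<le> 0" using polar_component_component[OF q] by simp
qed

lemma polar_component_antimono:
  assumes "0 \<le> q" "q \<le> q'"
  shows "polar_component q' \<le> polar_component q"
proof (rule polar_component_least)
  fix x :: 'a
  assume x: "0 \<le> x" "x \<le> 1" "inf x q' = 0"
  have "inf x q = 0" by (rule disjoint_mono[OF x(3,1) order_refl assms])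
  with x(1,2) show "x \<le> polar_component q" by (rule polar_component_upper)
qed (use assms in auto)

text \<open>
  The products of \<open>q\<close> with the positive and the negative part of \<open>u\<close> are disjoint and the first is
  at most the second, so \<open>q * pprt u = 0\<close>. The square of \<open>inf (pprt u) q\<close> is below this product,
  and there are no nonzero nilpotents.
\<close>

lemma disjoint_pprt_of_mult_nonpos:
  fixes q u :: "'a::{universally_complete_vector_lattice, phi_algebra}"
  assumes q: "0 \<le> q" and le: "q * u \<le> 0"
  shows "inf (pprt u) q = 0"
proof -
  let ?p = "pprt u"
  have p0: "0 \<le> ?p" by (simp add: pprt_def)
  have "inf (q * ?p) (?p - u) = 0"
    by (rule mult_left_disjoint[OF disjoint_pprt q])
  then have "inf (q * (?p - u)) (q * ?p) = 0"
    using q by (intro mult_left_disjoint) (simp_all add: inf_commute)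
  moreover have "q * ?p \<le> q * (?p - u)" using le by (simp add: algebra_simps)
  ultimately have qp: "q * ?p = 0" by (simp add: inf_absorb2)
  let ?v = "inf ?p q"
  have v: "0 \<le> ?v" using p0 q by simp
  have "?v * ?v \<le> q * ?p" using v p0 q by (intro mult_mono) auto
  then have "?v * ?v = 0" using qp square_nonneg[of ?v] by (intro antisym) auto
  then have "?v ^ Suc 1 = 0" by simp
  with v show ?thesis by (rule nilpotent_eq_zero)
qed

text \<open>
  The only place where lateral completeness enters. The bands generated by the increasing \<open>q j\<close>
  exhaust the space, and on the \<open>j\<close>-th of them \<open>S\<close> is bounded by \<open>M j\<close>. The differences \<open>d j\<close> of
  consecutive band components form a partition of the identity, so the products \<open>d j * M j\<close> are
  disjoint and have a common upper bound \<open>U\<close>, which dominates \<open>S\<close> on each piece and hence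
  everywhere.
\<close>

lemma locally_bounded_imp_bounded:
  fixes S M q :: "nat \<Rightarrow> 'a::{universally_complete_vector_lattice, phi_algebra}"
  assumes q: "\<And>j. 0 \<le> q j" "incseq q"
    and total: "\<And>x. 0 \<le> x \<Longrightarrow> (\<And>j. inf x (q j) = 0) \<Longrightarrow> x \<le> 0"
    and S: "\<And>N. 0 \<le> S N" and M: "\<And>j. 0 \<le> M j"
    and local: "\<And>j N. q j * S N \<le> q j * M j"
  shows "\<exists>U. \<forall>N. S N \<le> U"
proof -
  \<comment> \<open>The components decrease from the identity, which \<open>p 0\<close> supplies, to zero.\<close>
  define e where "e j = polar_component (q j)" for j
  define p where "p j = (case j of 0 \<Rightarrow> 1 | Suc i \<Rightarrow> e i)" for j
  define d where "d j = p j - e j" for j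
  have e01: "0 \<le> e j" "e j \<le> 1" for j
    using polar_component_bounds[OF q(1)] by (auto simp: e_def)
  have e_comp: "inf (e j) (1 - e j) = 0" for j
    unfolding e_def by (rule polar_component_component[OF q(1)])
  have e_dec: "e j \<le> e i" if "i \<le> j" for i j
    unfolding e_def using q that by (intro polar_component_antimono) (auto simp: incseq_def)
  have p_comp: "inf (p j) (1 - p j) = 0" for j
    using e_comp inf_absorb2[OF one_nonneg] by (cases j) (auto simp: p_def)
  have p1: "p j \<le> 1" and ep: "e j \<le> p j" for j
    using e01 e_dec by (auto simp: p_def split: nat.split)
  have d: "0 \<le> d j" "d j \<le> 1 - e j" "d j \<le> p j" for j
    using p1[of j] ep[of j] e01(1)[of j] by (simp_all add: d_def)
  \<comment> \<open>A difference of two nested components is again a component, hence idempotent.\<close>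
  have d_idem: "d j * d j = d j" for j
  proof -
    have "inf (e j) (1 - p j) = 0"
      by (rule disjoint_mono[OF p_comp[of j] e01(1) ep]) (use p1 in auto)
    then have "e j * (1 - p j) = 0" "(1 - p j) * e j = 0"
      by (auto intro!: disjoint_mult_zero simp: inf_commute)
    moreover have "e j * (1 - e j) = 0" "p j * (1 - p j) = 0"
      using e_comp[of j] p_comp[of j] by (auto intro!: disjoint_mult_zero)
    ultimately show ?thesis by (simp add: d_def algebra_simps)
  qed
  have d_less: "inf (d i) (d j) = 0" if "i < j" for i j
  proof -
    have "p j \<le> e i" using that by (cases j) (auto simp: p_def e_dec)
    then have "d j \<le> e i" using d(3)[of j] by (rule order_trans[rotated])
    then have "inf (d j) (d i) = 0"
      using d by (intro disjoint_mono[OF e_comp[of i]]) auto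
    then show ?thesis by (simp add: inf_commute)
  qed
  have d_disj: "inf (d i) (d j) = 0" if "i \<noteq> j" for i j
    using d_less[of i j] d_less[of j i] that by (cases "i < j") (auto simp: inf_commute)
  define D where "D j = d j * M j" for j
  have D0: "0 \<le> D j" for j using d M by (simp add: D_def mult_positive)
  have D_disj: "inf (D i) (D j) = 0" if "i \<noteq> j" for i j
  proof -
    have "inf (D i) (d j) = 0"
      unfolding D_def by (rule mult_right_disjoint[OF d_disj[OF that] M])
    then have "inf (D j) (D i) = 0"
      unfolding D_def[of j] by (intro mult_right_disjoint[OF _ M]) (simp add: inf_commute)
    then show ?thesis by (simp add: inf_commute)
  qed
  have "inf x y = 0" if "x \<in> range D" "y \<in> range D" "x \<noteq> y" for x y
    using that D_disj by (metis imageE)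
  then have "\<exists>U. (\<forall>x\<in>range D. x \<le> U) \<and> (\<forall>u. (\<forall>x\<in>range D. x \<le> u) \<longrightarrow> U \<le> u)"
    using D0 by (intro laterally_complete) auto
  then obtain U where U: "\<And>j. D j \<le> U" by blast
  have U0: "0 \<le> U" using D0 U order_trans by blast
  have dS: "d j * S N \<le> d j * U" for j N
  proof -
    have "q j * (S N - M j) \<le> 0" using local[of j N] by (simp add: algebra_simps)
    then have "inf (pprt (S N - M j)) (q j) = 0"
      by (rule disjoint_pprt_of_mult_nonpos[OF q(1)])
    then have "inf (pprt (S N - M j)) (1 - e j) = 0"
      unfolding e_def by (intro polar_component_complement q) (auto simp: pprt_def)
    then have "inf (d j) (pprt (S N - M j)) = 0"
      using d by (subst inf_commute, elim disjoint_mono) (auto simp: pprt_def)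
    then have "d j * pprt (S N - M j) = 0" by (rule disjoint_mult_zero)
    moreover have "d j * (S N - M j) \<le> d j * pprt (S N - M j)"
      using d by (intro mult_left_mono) (auto simp: pprt_def)
    ultimately have "d j * S N \<le> d j * M j" by (simp add: algebra_simps)
    also have "\<dots> = d j * D j" by (simp add: D_def d_idem flip: mult.assoc)
    also have "\<dots> \<le> d j * U" using U d by (intro mult_left_mono) auto
    finally show ?thesis .
  qed
  have d_sum: "(\<Sum>i\<le>j. d i) = 1 - e j" for j
    by (induction j) (simp_all add: d_def p_def)
  \<comment> \<open>Summing the pieces leaves the error \<open>e j * S N\<close>, whose infimum over \<open>j\<close> is zero.\<close>
  have "S N \<le> U" for N
  proof -
    have "S N - U \<le> 0"
    proof (rule inf_zero_mult_right[where I = UNIV and z = e and C = "S N" and b = 1])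
      fix j
      have "(1 - e j) * S N = (\<Sum>i\<le>j. d i * S N)"
        by (simp add: d_sum flip: sum_distrib_right)
      also have "\<dots> \<le> (\<Sum>i\<le>j. d i * U)" by (intro sum_mono dS)
      also have "\<dots> = (1 - e j) * U"
        by (simp add: d_sum flip: sum_distrib_right)
      also have "\<dots> \<le> 1 * U"
        using U0 e01[of j] by (intro mult_right_mono) auto
      finally show "S N - U \<le> e j * S N" by (simp add: algebra_simps)
    next
      fix v :: 'a
      assume v: "\<And>j. j \<in> UNIV \<Longrightarrow> v \<le> e j"
      have "pprt v \<le> 0"
      proof (rule total)
        fix j
        have "pprt v \<le> e j" using v[of j] e01(1)[of j] by (simp add: pprt_def)
        then show "inf (pprt v) (q j) = 0"
          using polar_component_disjoint[OF q(1)[of j]] q(1)[of j]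
          by (elim disjoint_mono[rotated 2, OF _ _ order_refl, rotated 2]) (auto simp: pprt_def e_def)
      qed (simp add: pprt_def)
      then show "v \<le> 0" by (simp add: pprt_def)
    qed (use S e01 in auto)
    then show ?thesis by simp
  qed
  then show ?thesis by blast
qed

section \<open>Modulus and order convergent series\<close>

text \<open>
  Every angle can be reduced to the interval of the definition. Angles beyond it arise when \<open>pi\<close>
  is added in order to change a sign.
\<close>

lemma modulus_upper:
  "cos \<theta> *\<^sub>R re_part x + sin \<theta> *\<^sub>R im_part x \<le> modulus x"
proof -
  obtain t where "0 \<le> t" "t \<le> 2 * pi" "cos \<theta> = cos t" "sin \<theta> = sin t"
    using sincos_total_2pi_le[of "cos \<theta>" "sin \<theta>"] by auto
  then show ?thesis
    unfolding modulus_def by (intro cSUP_upper2[OF bdd_above_square_mean, of t]) auto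
qed

lemma modulus_diff_le: "modulus (u - v) \<le> modulus u + modulus v"
proof -
  have "cos \<theta> *\<^sub>R re_part (u - v) + sin \<theta> *\<^sub>R im_part (u - v) \<le> modulus u + modulus v" for \<theta>
    using add_mono[OF modulus_upper[of \<theta> u] modulus_upper[of "\<theta> + pi" v]]
    by (simp add: minus_complexification_def algebra_simps)
  then show ?thesis
    unfolding modulus_def[of "u - v"] by (intro cSUP_least) auto
qed

lemma modulus_nonneg: "0 \<le> modulus x"
proof -
  have "0 \<le> modulus x + modulus x"
    using add_mono[OF modulus_upper[of 0 x] modulus_upper[of pi x]] by simp
  then show ?thesis by simp
qed

lemma re_part_le_modulus: "re_part x \<le> modulus x"
  using modulus_upper[of 0 x] by simp

lemma modulus_Cplx_nonneg: "0 \<le> u \<Longrightarrow> modulus (Cplx u 0) = u"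
  by (simp add: modulus_real)

lemma sum_Cplx: "(\<Sum>n\<le>N. Cplx (u n) 0) = Cplx (\<Sum>n\<le>N. u n) 0" for N :: nat
  by (induction N) (simp_all add: plus_complexification_def zero_complexification_def)

text \<open>
  The partial sums \<open>S N\<close> increase to their supremum \<open>T\<close>, which is the limit with \<open>T - S N\<close> as
  dominating sequence.
\<close>

lemma nonneg_series_order_converges:
  assumes u: "\<And>n. 0 \<le> u n" and bound: "\<And>N. (\<Sum>n\<le>N. u n) \<le> U"
  shows "series_order_converges (\<lambda>n. Cplx (u n) 0)"
proof -
  define S where "S N = (\<Sum>n\<le>N. u n)" for N
  define T where "T = (SUP N. S N)"
  have bdd: "bdd_above (range S)" using bound by (auto intro!: bdd_aboveI simp: S_def)
  have up: "S N \<le> T" for N unfolding T_def by (rule cSUP_upper[OF UNIV_I bdd])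
  have "(INF N. T - S N) = 0"
  proof (rule antisym)
    have "S N \<le> T - (INF N. T - S N)" for N
    proof -
      have "(INF N. T - S N) \<le> T - S N"
        by (rule cINF_lower) (use up in \<open>auto intro!: bdd_belowI[of _ 0]\<close>)
      then show ?thesis by (simp add: algebra_simps)
    qed
    then have "T \<le> T - (INF N. T - S N)"
      by (subst T_def, intro cSUP_least) auto
    then show "(INF N. T - S N) \<le> 0" by simp
    show "0 \<le> (INF N. T - S N)" using up by (intro cINF_greatest) auto
  qed
  moreover have "decseq (\<lambda>N. T - S N)"
    by (rule decseq_SucI) (simp add: S_def u)
  moreover have "modulus (Cplx (S N) 0 - Cplx T 0) \<le> T - S N" for N
    using up[of N] by (simp add: minus_complexification_def modulus_real abs_minus_commute[of "S N" T])
  ultimately show ?thesis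
    unfolding series_order_converges_def order_converges_to_def
    using up by (intro exI[of _ "Cplx T 0"] exI[of _ "\<lambda>N. T - S N"]) (auto simp: sum_Cplx S_def)
qed

lemma series_order_converges_partial_sums:
  assumes "series_order_converges a"
  obtains s K where "\<And>N. modulus ((\<Sum>n\<le>N. a n) - s) \<le> K"
proof -
  from assms obtain s p where p: "decseq p" "\<And>N. modulus ((\<Sum>n\<le>N. a n) - s) \<le> p N"
    unfolding series_order_converges_def order_converges_to_def by blast
  have "modulus ((\<Sum>n\<le>N. a n) - s) \<le> p 0" for N
    using p(2)[of N] p(1) by (auto simp: decseq_def intro: order_trans)
  then show ?thesis by (rule that)
qed

lemma order_convergent_series_terms_bounded:
  assumes "series_order_converges a"
  obtains B where "\<And>n. n \<ge> 1 \<Longrightarrow> modulus (a n) \<le> B"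
proof -
  obtain s K where K: "\<And>N. modulus ((\<Sum>n\<le>N. a n) - s) \<le> K"
    using series_order_converges_partial_sums[OF assms] by blast
  have "modulus (a n) \<le> K + K" if "n \<ge> 1" for n
  proof -
    obtain m where m: "n = Suc m" using \<open>n \<ge> 1\<close> by (cases n) auto
    have "a n = ((\<Sum>i\<le>Suc m. a i) - s) - ((\<Sum>i\<le>m. a i) - s)" by (simp add: m)
    then have "modulus (a n) \<le> modulus ((\<Sum>i\<le>Suc m. a i) - s) + modulus ((\<Sum>i\<le>m. a i) - s)"
      by (metis modulus_diff_le)
    also have "\<dots> \<le> K + K" by (intro add_mono K)
    finally show ?thesis .
  qed
  then show ?thesis by (rule that)
qed

lemma root_sequence_power:
  assumes "n \<ge> 1"
  shows "0 \<le> root_sequence a n" "root_sequence a n ^ n = modulus (a n)"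
  using positive_root_power[OF assms modulus_nonneg] by (auto simp: root_sequence_def)

lemma order_bounded_root_sequence:
  assumes "\<And>n. n \<ge> 1 \<Longrightarrow> root_sequence a n \<le> B"
  shows "order_bounded_sequence (root_sequence a)"
  unfolding order_bounded_sequence_def
  using assms root_sequence_power(1) by (auto intro!: bdd_aboveI[of _ B] bdd_belowI[of _ 0])

section \<open>The limit superior\<close>

context
  fixes x :: "nat \<Rightarrow> 'a::conditionally_complete_lattice"
  assumes bounded: "order_bounded_sequence x"
begin

lemma tail_bdd_above: "n \<ge> 1 \<Longrightarrow> bdd_above (x ` {n..})"
  using bounded unfolding order_bounded_sequence_def
  by (meson bdd_above_mono image_mono atLeast_subset_iff)

lemma le_tail_sup: "1 \<le> n \<Longrightarrow> n \<le> m \<Longrightarrow> x m \<le> (SUP m\<in>{n..}. x m)"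
  by (rule cSUP_upper[OF _ tail_bdd_above]) auto

lemma tail_sup_antimono: "1 \<le> n \<Longrightarrow> n \<le> m \<Longrightarrow> (SUP m\<in>{m..}. x m) \<le> (SUP m\<in>{n..}. x m)"
  by (rule cSUP_subset_mono) (auto intro: tail_bdd_above)

lemma bdd_below_tail_sups: "bdd_below ((\<lambda>n. SUP m\<in>{n..}. x m) ` {1..})"
proof -
  obtain l where "\<And>n. n \<ge> 1 \<Longrightarrow> l \<le> x n"
    using bounded unfolding order_bounded_sequence_def bdd_below_def by auto
  then have "l \<le> (SUP m\<in>{n..}. x m)" if "n \<ge> 1" for n
    using le_tail_sup[OF that order_refl] that by (meson order_trans)
  then show ?thesis
    by (intro bdd_belowI[of _ l]) auto
qed

lemma order_limsup_le_tail_sup: "1 \<le> n \<Longrightarrow> order_limsup x \<le> (SUP m\<in>{n..}. x m)"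
  unfolding order_limsup_def by (rule cINF_lower[OF bdd_below_tail_sups]) auto

lemma order_limsup_le:
  assumes "1 \<le> n" "\<And>m. n \<le> m \<Longrightarrow> x m \<le> c"
  shows "order_limsup x \<le> c"
  using order_limsup_le_tail_sup[OF assms(1)] by (rule order_trans) (use assms(2) in \<open>auto intro!: cSUP_least\<close>)

end

lemma order_limsup_greatest:
  assumes "\<And>n. 1 \<le> n \<Longrightarrow> w \<le> (SUP m\<in>{n..}. x m)"
  shows "w \<le> order_limsup x"
  unfolding order_limsup_def using assms by (intro cINF_greatest) auto


section \<open>The three parts of the root test\<close>

text \<open>
  On the band generated by \<open>q\<close> the element \<open>s\<close>, and with it \<open>r\<close>, is at most the scalar \<open>c\<close>.
\<close>

lemma pprt_mult_power_le:
  fixes r s :: "'a::phi_algebra"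
  assumes r: "0 \<le> r" "r \<le> s" and c: "0 \<le> c"
  defines "q \<equiv> pprt (c *\<^sub>R 1 - s)"
  shows "q * r ^ n \<le> c ^ n *\<^sub>R q"
proof (induction n)
  case (Suc n)
  have "q * (c *\<^sub>R 1 - s) = q * q" unfolding q_def by (rule mult_pprt)
  then have "0 \<le> q * (c *\<^sub>R 1 - s)" by (simp add: square_nonneg)
  also have "\<dots> \<le> q * (c *\<^sub>R 1 - r)"
    using r by (intro mult_left_mono) (auto simp: q_def pprt_def)
  finally have qr: "q * r \<le> c *\<^sub>R q" by (simp add: right_diff_distrib)
  have "q * r ^ Suc n = (q * r ^ n) * r" by (simp only: power_Suc2 mult.assoc)
  also have "\<dots> \<le> (c ^ n *\<^sub>R q) * r" using Suc r(1) by (rule mult_right_mono)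
  also have "\<dots> = c ^ n *\<^sub>R (q * r)" by simp
  also have "\<dots> \<le> c ^ n *\<^sub>R (c *\<^sub>R q)" using qr c by (intro scaleR_left_mono) auto
  also have "\<dots> = c ^ Suc n *\<^sub>R q" by (simp add: mult.commute)
  finally show ?case .
qed simp

text \<open>
  With \<open>s j\<close> the supremum of the roots beyond \<open>j\<close> and \<open>c j = 1 - 1 / (j + 1)\<close>, the terms beyond \<open>j\<close>
  are dominated by a geometric series of ratio \<open>c j\<close> on the band where \<open>s j\<close> stays below \<open>c j\<close>,
  that is, on the band generated by \<open>q j = pprt (c j - s j)\<close>. The remaining terms are finitely many, so
  the partial sums are bounded on each of these bands. As \<open>s j\<close> decreases to the limit superior
  and \<open>c j\<close> increases to \<open>1\<close>, the bands exhaust the one generated by \<open>pprt (1 - L)\<close>, which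
  by hypothesis is the whole space.
\<close>

lemma absolutely_convergent_of_limsup_strongly_below:
  fixes a :: "nat \<Rightarrow> 'a::{universally_complete_vector_lattice, phi_algebra} complexification"
  assumes bounded: "order_bounded_sequence (root_sequence a)"
    and below: "order_limsup (root_sequence a) \<lless> 1"
  shows "series_absolutely_order_converges a"
proof -
  define r where "r = root_sequence a"
  define L where "L = order_limsup r"
  define u where "u n = modulus (a n)" for n
  have r: "0 \<le> r n" "r n ^ n = u n" if "n \<ge> 1" for n
    using root_sequence_power[OF that] by (simp_all add: r_def u_def)
  have u0: "0 \<le> u n" for n by (simp add: u_def modulus_nonneg)
  define s where "s j = (SUP m\<in>{Suc j..}. r m)" for j
  have rs: "r m \<le> s j" if "j < m" for j m
    unfolding s_def r_def using that by (intro le_tail_sup[OF bounded]) auto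
  have s_dec: "s j \<le> s i" if "i \<le> j" for i j
    unfolding s_def r_def using that by (intro tail_sup_antimono[OF bounded]) auto
  define c where "c j = 1 - inverse (real (Suc j))" for j
  have c: "0 \<le> c j" for j by (simp add: c_def field_simps)
  have c_mono: "c i \<le> c j" if "i \<le> j" for i j
    using that by (simp add: c_def field_simps)
  define q where "q j = pprt (c j *\<^sub>R 1 - s j)" for j
  have q0: "0 \<le> q j" for j by (simp add: q_def pprt_def)
  have q_inc: "incseq q"
  proof (rule incseq_SucI)
    fix j
    have "c j *\<^sub>R 1 - s j \<le> c (Suc j) *\<^sub>R 1 - s (Suc j)"
      using one_nonneg[where 'a='a] by (intro diff_mono scaleR_right_mono c_mono s_dec) auto
    then show "q j \<le> q (Suc j)" unfolding q_def pprt_def by (intro sup_mono) auto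
  qed
  have total: "x \<le> 0" if x: "0 \<le> x" "\<And>j. inf x (q j) = 0" for x
  proof -
    let ?P = "pprt (1 - L)"
    define y where "y = inf ?P x"
    have P0: "0 \<le> ?P" by (simp add: pprt_def)
    have y0: "0 \<le> y" using P0 x by (simp add: y_def)
    \<comment> \<open>\<open>pprt (1 - L)\<close> exceeds \<open>q j\<close> by at most \<open>1 / (j + 1) + (s j - L)\<close>, and \<open>y\<close> is disjoint from \<open>q j\<close>.\<close>
    have y_le: "y \<le> inverse (real (Suc j)) *\<^sub>R 1 + (s j - L)" for j
    proof -
      let ?z = "inverse (real (Suc j)) *\<^sub>R 1 + (s j - L)"
      have sL: "L \<le> s j"
        unfolding L_def s_def r_def by (rule order_limsup_le_tail_sup[OF bounded]) simp
      have z0: "0 \<le> ?z" using sL one_nonneg[where 'a='a]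
        by (intro add_nonneg_nonneg scaleR_nonneg_nonneg) auto
      have "1 - L = (c j *\<^sub>R 1 - s j) + ?z" by (simp add: c_def scaleR_diff_left)
      also have "\<dots> \<le> q j + ?z" by (intro add_right_mono) (simp add: q_def pprt_def)
      finally have "?P \<le> q j + ?z" using q0 z0 by (simp add: pprt_def)
      then have "y - ?z \<le> q j" using le_infE[of y ?P x] by (simp add: y_def diff_le_eq order_trans[OF inf_le1])
      moreover have "y - ?z \<le> x"
        using z0 inf_le2[of ?P x] by (metis add_increasing2 diff_le_eq y_def)
      ultimately have "y - ?z \<le> 0" using x(2)[of j] by (metis le_infI)
      then show ?thesis by simp
    qed
    \<comment> \<open>Let first \<open>s j\<close> tend to \<open>L\<close> while the scalar error stays fixed.\<close>
    have "y \<le> inverse (real (Suc k)) *\<^sub>R 1" for k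
    proof -
      have "y + L - inverse (real (Suc k)) *\<^sub>R 1 \<le> s j" for j
      proof -
        have "y + L - inverse (real (Suc k)) *\<^sub>R 1 \<le> s (max j k)"
        proof -
          have "inverse (real (Suc (max j k))) *\<^sub>R (1::'a) \<le> inverse (real (Suc k)) *\<^sub>R 1"
            using one_nonneg[where 'a='a] by (intro scaleR_right_mono) (auto simp: field_simps)
          then have "y \<le> inverse (real (Suc k)) *\<^sub>R 1 + (s (max j k) - L)"
            using y_le[of "max j k"] by (meson add_right_mono order_trans)
          then show ?thesis by (simp add: algebra_simps)
        qed
        also have "\<dots> \<le> s j" by (rule s_dec) simp
        finally show ?thesis .
      qed
      then have "y + L - inverse (real (Suc k)) *\<^sub>R 1 \<le> (SUP m\<in>{n..}. r m)" if "n \<ge> 1" for n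
        using that by (cases n) (auto simp: s_def)
      then have "y + L - inverse (real (Suc k)) *\<^sub>R 1 \<le> L"
        unfolding L_def by (rule order_limsup_greatest)
      then show ?thesis by (simp add: algebra_simps)
    qed
    then have "y \<le> 0 + inverse (real n) *\<^sub>R 1" if "n \<ge> 1" for n
      using that by (cases n) auto
    then have "y \<le> 0" by (rule archimedean_bound)
    with y0 have "y = 0" by (rule antisym[rotated])
    with x(1) have "inf ?P \<bar>x\<bar> = 0" by (simp add: y_def)
    then have "x = 0"
      using below unfolding strongly_below_def weak_order_unit_def L_def r_def by blast
    then show ?thesis by simp
  qed
  define S where "S N = (\<Sum>n\<le>N. u n)" for N
  define M where "M j = S j + real (Suc j) *\<^sub>R 1" for j
  have S0: "0 \<le> S N" for N unfolding S_def by (intro sum_nonneg u0)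
  have M0: "0 \<le> M j" for j
    unfolding M_def using S0 one_nonneg by (intro add_nonneg_nonneg scaleR_nonneg_nonneg) auto
  have q_power: "q j * r m ^ n \<le> c j ^ n *\<^sub>R q j" if m: "j < m" for j m n
    unfolding q_def using r(1)[of m] rs[OF m] c m by (intro pprt_mult_power_le) auto
  have q_sum: "q j * S N \<le> q j * S j + (\<Sum>n\<le>N. c j ^ n) *\<^sub>R q j" for j N
  proof (induction N)
    case 0
    have "q j * S 0 \<le> q j * S j"
      unfolding S_def by (intro mult_left_mono q0 sum_mono2) (auto intro: u0)
    then show ?case using q0[of j] by (simp add: add_increasing2)
  next
    case (Suc N)
    show ?case
    proof (cases "Suc N \<le> j")
      case True
      then have "q j * S (Suc N) \<le> q j * S j"
        unfolding S_def by (intro mult_left_mono q0 sum_mono2) (auto intro: u0)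
      moreover have "0 \<le> (\<Sum>n\<le>Suc N. c j ^ n) *\<^sub>R q j"
        using c q0 by (intro scaleR_nonneg_nonneg sum_nonneg) auto
      ultimately show ?thesis by (rule add_increasing2[rotated])
    next
      case False
      have "q j * S (Suc N) = q j * S N + q j * r (Suc N) ^ Suc N"
        by (simp add: S_def distrib_left r del: power_Suc)
      also have "\<dots> \<le> (q j * S j + (\<Sum>n\<le>N. c j ^ n) *\<^sub>R q j) + c j ^ Suc N *\<^sub>R q j"
        using False by (intro add_mono Suc q_power) auto
      also have "\<dots> = q j * S j + (\<Sum>n\<le>Suc N. c j ^ n) *\<^sub>R q j"
        by (simp add: scaleR_add_left del: power_Suc)
      finally show ?thesis .
    qed
  qed
  have "\<exists>U. \<forall>N. S N \<le> U"
  proof (rule locally_bounded_imp_bounded[of q, OF q0 q_inc total S0 M0])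
    fix j N
    \<comment> \<open>The geometric series of ratio \<open>c j\<close> has sum \<open>j + 1\<close>.\<close>
    have "(1 - c j) * (\<Sum>n\<le>N. c j ^ n) = 1 - c j ^ Suc N"
      using one_diff_power_eq[of "c j" "Suc N"] by (simp add: lessThan_Suc_atMost)
    also have "\<dots> \<le> 1" using c[of j] by (simp del: power_Suc)
    finally have "(\<Sum>n\<le>N. c j ^ n) \<le> real (Suc j)"
      by (simp add: c_def field_simps del: power_Suc)
    then have "(\<Sum>n\<le>N. c j ^ n) *\<^sub>R q j \<le> real (Suc j) *\<^sub>R q j"
      using q0 by (rule scaleR_right_mono)
    then have "q j * S j + (\<Sum>n\<le>N. c j ^ n) *\<^sub>R q j \<le> q j * S j + real (Suc j) *\<^sub>R q j"
      by (rule add_left_mono)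
    also have "\<dots> = q j * M j" by (simp only: M_def distrib_left mult_scaleR_right mult_1_right)
    finally show "q j * S N \<le> q j * M j" using q_sum[of j N] by (rule order_trans[rotated])
  qed
  then show ?thesis
    unfolding series_absolutely_order_converges_def u_def[symmetric]
    using nonneg_series_order_converges[of u] u0 by (auto simp: S_def)
qed

text \<open>
  The terms of an order convergent series have a common bound \<open>B\<close>, and Bernoulli's inequality turns
  \<open>r ^ n \<le> B\<close> into \<open>r \<le> 1 + B / n\<close>.
\<close>

lemma root_sequence_of_order_convergent_series:
  fixes a :: "nat \<Rightarrow> 'a::{universally_complete_vector_lattice, phi_algebra} complexification"
  assumes "series_order_converges a"
  shows "order_bounded_sequence (root_sequence a)" "order_limsup (root_sequence a) \<le> 1"
proof -
  let ?r = "root_sequence a"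
  obtain B where B: "\<And>n. n \<ge> 1 \<Longrightarrow> modulus (a n) \<le> B"
    using order_convergent_series_terms_bounded[OF assms] by blast
  have B0: "0 \<le> B" using B[of 1] modulus_nonneg[of "a 1"] by simp
  have r_le: "?r m \<le> 1 + inverse (real n) *\<^sub>R B" if "1 \<le> n" "n \<le> m" for m n
  proof -
    have "?r m \<le> 1 + inverse (real m) *\<^sub>R B"
      using that B root_sequence_power[of m a] by (intro le_one_plus_of_power_le) auto
    also have "\<dots> \<le> 1 + inverse (real n) *\<^sub>R B"
      using that B0 by (intro add_left_mono scaleR_right_mono) (auto simp: field_simps)
    finally show ?thesis .
  qed
  show bounded: "order_bounded_sequence ?r"
    using r_le[of 1] by (intro order_bounded_root_sequence) auto
  show "order_limsup ?r \<le> 1"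
  proof (rule archimedean_bound)
    fix n :: nat
    assume n: "n \<ge> 1"
    show "order_limsup ?r \<le> 1 + inverse (real n) *\<^sub>R B"
      using r_le[OF n] by (rule order_limsup_le[OF bounded n])
  qed
qed

lemma root_sequence_of_powers:
  fixes x :: "nat \<Rightarrow> 'a::{universally_complete_vector_lattice, phi_algebra}"
  assumes "n \<ge> 1" "0 \<le> x n"
  shows "root_sequence (\<lambda>n. Cplx (x n ^ n) 0) n = x n"
  using assms power_nonneg[OF assms(2)]
  by (simp add: root_sequence_def modulus_Cplx_nonneg positive_root_eqI)

text \<open>
  Both examples that show the test to be inconclusive have root sequences of this form. A tail
  supremum falls short of \<open>L\<close> by at most \<open>(1 - c m) L\<close>, for arbitrarily large \<open>m\<close>.
\<close>

lemma order_limsup_scaled_const: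
  fixes L :: "'a::universally_complete_vector_lattice"
  assumes L: "0 \<le> L" and x: "\<And>n. n \<ge> 1 \<Longrightarrow> x n = c n *\<^sub>R L"
    and c: "\<And>n. n \<ge> 1 \<Longrightarrow> 0 \<le> c n" "\<And>n. n \<ge> 1 \<Longrightarrow> c n \<le> 1" "c \<longlonglongrightarrow> 1"
  shows "order_bounded_sequence x" "order_limsup x = L"
proof -
  have x_le: "x n \<le> L" and x0: "0 \<le> x n" if "n \<ge> 1" for n
    using x[OF that] c(1,2)[OF that] L scaleR_right_mono[of "c n" 1 L]
    by (simp_all add: scaleR_nonneg_nonneg)
  show bounded: "order_bounded_sequence x"
    unfolding order_bounded_sequence_def
    using x_le x0 by (auto intro!: bdd_aboveI[of _ L] bdd_belowI[of _ 0])
  show "order_limsup x = L"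
  proof (rule antisym)
    show "order_limsup x \<le> L"
      by (rule order_limsup_le[OF bounded order_refl x_le])
    show "L \<le> order_limsup x"
    proof (rule order_limsup_greatest)
      fix n :: nat
      assume n: "1 \<le> n"
      let ?s = "SUP m\<in>{n..}. x m"
      show "L \<le> ?s"
      proof (rule archimedean_bound)
        fix k :: nat
        assume k: "k \<ge> 1"
        have "\<forall>\<^sub>F m in sequentially. 1 - inverse (real k) < c m"
          using c(3) k by (intro order_tendstoD) auto
        then obtain m where m: "n \<le> m" "1 - inverse (real k) < c m"
          by (metis (mono_tags, lifting) eventually_sequentially nle_le)
        have "(1 - c m) *\<^sub>R L \<le> inverse (real k) *\<^sub>R L"
          using m L by (intro scaleR_right_mono) auto
        moreover have "c m *\<^sub>R L \<le> ?s"
          using le_tail_sup[OF bounded n m(1)] x[of m] n m by simp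
        ultimately have "c m *\<^sub>R L + (1 - c m) *\<^sub>R L \<le> ?s + inverse (real k) *\<^sub>R L"
          by (intro add_mono)
        then show "L \<le> ?s + inverse (real k) *\<^sub>R L"
          by (simp flip: scaleR_add_left)
      qed
    qed
  qed
qed

text \<open>
  The series of the \<open>L ^ n / n\<^sup>2\<close>: the scalar factors \<open>n powr (- 2 / n)\<close> of the roots tend to \<open>1\<close>.
\<close>

lemma convergent_series_with_limsup:
  fixes L :: "'a::{universally_complete_vector_lattice, phi_algebra}"
  assumes L: "0 \<le> L" "L \<le> 1"
  shows "\<exists>b :: nat \<Rightarrow> 'a complexification.
    order_bounded_sequence (root_sequence b) \<and> order_limsup (root_sequence b) = L
    \<and> series_absolutely_order_converges b"
proof -
  define c where "c n = inverse (root n (real n)) ^ 2" for n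
  define b where "b n = Cplx ((c n *\<^sub>R L) ^ n) 0" for n
  have c0: "0 \<le> c n" for n by (simp add: c_def)
  have c1: "c n \<le> 1" if "n \<ge> 1" for n
    using that by (simp add: c_def field_simps power_le_one)
  have "(\<lambda>n. inverse (root n (real n)) ^ 2) \<longlonglongrightarrow> inverse 1 ^ 2"
    by (intro tendsto_intros LIMSEQ_root) auto
  then have c_lim: "c \<longlonglongrightarrow> 1" by (simp add: c_def[abs_def])
  have cL: "0 \<le> c n *\<^sub>R L" for n using c0 L by (simp add: scaleR_nonneg_nonneg)
  have root: "root_sequence b n = c n *\<^sub>R L" if "n \<ge> 1" for n
    unfolding b_def by (rule root_sequence_of_powers[OF that cL])
  have c_power: "c n ^ n = inverse (real n ^ 2)" if "n \<ge> 1" for n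
  proof -
    have "c n ^ n = inverse (root n (real n) ^ n) ^ 2"
      by (simp add: c_def power_inverse mult.commute flip: power_mult)
    also have "root n (real n) ^ n = real n" using that by (intro real_root_pow_pos2) auto
    finally show ?thesis by (simp add: power_inverse)
  qed
  have scale_power: "(t *\<^sub>R L) ^ n = t ^ n *\<^sub>R L ^ n" for t n
    by (induction n) (simp_all add: algebra_simps)
  have L_power: "L ^ n \<le> 1" for n using power_mono_nonneg[OF L, of n] by simp
  have term0: "0 \<le> (c n *\<^sub>R L) ^ n" for n by (rule power_nonneg[OF cL])
  have summable: "summable (\<lambda>n. c n ^ n)"
  proof (rule summable_comparison_test')
    show "summable (\<lambda>n. inverse (real n ^ 2))" by (rule inverse_power_summable) simp
    show "norm (c n ^ n) \<le> inverse (real n ^ 2)" if "n \<ge> 1" for n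
      using c_power[OF that] by simp
  qed
  have "(\<Sum>n\<le>N. (c n *\<^sub>R L) ^ n) \<le> (\<Sum>n. c n ^ n) *\<^sub>R 1" for N
  proof -
    have "(\<Sum>n\<le>N. (c n *\<^sub>R L) ^ n) \<le> (\<Sum>n\<le>N. c n ^ n *\<^sub>R 1)"
      unfolding scale_power using c0 L_power by (intro sum_mono scaleR_left_mono) auto
    also have "\<dots> = (\<Sum>n\<le>N. c n ^ n) *\<^sub>R 1" by (simp add: scaleR_sum_left)
    also have "\<dots> \<le> (\<Sum>n. c n ^ n) *\<^sub>R 1"
      using c0 one_nonneg by (intro scaleR_right_mono sum_le_suminf[OF summable]) auto
    finally show ?thesis .
  qed
  then have "series_absolutely_order_converges b"
    unfolding series_absolutely_order_converges_def b_def modulus_Cplx_nonneg[OF term0]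
    by (rule nonneg_series_order_converges[OF term0])
  then show ?thesis
    using order_limsup_scaled_const[OF L(1) root c0 c1 c_lim] by blast
qed

text \<open>
  The series of the \<open>L ^ n\<close>. As \<open>1 - L\<close> is not a weak order unit, it is disjoint from some \<open>x \<noteq> 0\<close>,
  which \<open>L\<close> then fixes. The \<open>n\<close>-th partial sum multiplies \<open>\<bar>x\<bar>\<close> by \<open>n + 1\<close>, so the partial sums
  have no upper bound.
\<close>

lemma divergent_series_with_limsup:
  fixes L :: "'a::{universally_complete_vector_lattice, phi_algebra}"
  assumes L: "0 \<le> L" "L \<le> 1" "\<not> L \<lless> 1"
  shows "\<exists>c :: nat \<Rightarrow> 'a complexification.
    order_bounded_sequence (root_sequence c) \<and> order_limsup (root_sequence c) = L
    \<and> \<not> series_order_converges c"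
proof -
  define c where "c n = Cplx (L ^ n) 0" for n
  have root: "root_sequence c n = 1 *\<^sub>R L" if "n \<ge> 1" for n
    using root_sequence_of_powers[OF that, of "\<lambda>_. L"] L by (simp add: c_def[abs_def])
  have "\<not> series_order_converges c"
  proof
    assume "series_order_converges c"
    then obtain s K where K: "\<And>N. modulus ((\<Sum>n\<le>N. c n) - s) \<le> K"
      by (rule series_order_converges_partial_sums[of c]) blast
    have sum_le: "(\<Sum>n\<le>N. L ^ n) \<le> K + re_part s" for N
    proof -
      have "(\<Sum>n\<le>N. L ^ n) - re_part s = re_part ((\<Sum>n\<le>N. c n) - s)"
        by (simp add: c_def sum_Cplx minus_complexification_def)
      also have "\<dots> \<le> K" using re_part_le_modulus K by (rule order_trans)
      finally show ?thesis by (simp add: diff_le_eq)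
    qed
    have "pprt (1 - L) = 1 - L" using L by (simp add: pprt_def sup_absorb1)
    then obtain x where x: "inf (1 - L) \<bar>x\<bar> = 0" "x \<noteq> 0"
      using L unfolding strongly_below_def weak_order_unit_def by auto
    have "(1 - L) * \<bar>x\<bar> = 0" using x(1) by (rule disjoint_mult_zero)
    then have Lx: "L * \<bar>x\<bar> = \<bar>x\<bar>" by (simp add: algebra_simps)
    have Lnx: "L ^ n * \<bar>x\<bar> = \<bar>x\<bar>" for n
      by (induction n) (simp_all add: mult.assoc Lx)
    have "\<bar>x\<bar> \<le> 0"
    proof (rule archimedean_vector_lattice)
      fix n :: nat
      have "real n *\<^sub>R \<bar>x\<bar> \<le> real (Suc n) *\<^sub>R \<bar>x\<bar>" by (intro scaleR_right_mono) auto
      also have "\<dots> = (\<Sum>i\<le>n. L ^ i) * \<bar>x\<bar>"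
        by (simp add: sum_distrib_right Lnx sum_constant_scaleR)
      also have "\<dots> \<le> (K + re_part s) * \<bar>x\<bar>"
        using sum_le by (intro mult_right_mono) auto
      finally show "real n *\<^sub>R \<bar>x\<bar> \<le> (K + re_part s) * \<bar>x\<bar>" .
    qed
    then show False using x(2) by simp
  qed
  moreover have "order_bounded_sequence (root_sequence c)" "order_limsup (root_sequence c) = L"
    using root by (auto intro: order_limsup_scaled_const[OF L(1), of _ "\<lambda>_. 1"])
  ultimately show ?thesis by blast
qed

theorem theorem3p6:
  fixes a :: "nat \<Rightarrow> 'a::{universally_complete_vector_lattice, phi_algebra} complexification"
  shows
    "(order_bounded_sequence (root_sequence a) \<and> order_limsup (root_sequence a) \<lless> 1
        \<longrightarrow> series_absolutely_order_converges a)
     \<and> (series_order_converges a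
        \<longrightarrow> order_bounded_sequence (root_sequence a) \<and> order_limsup (root_sequence a) \<le> 1)
     \<and> (order_bounded_sequence (root_sequence a)
          \<and> \<not> order_limsup (root_sequence a) \<lless> 1 \<and> order_limsup (root_sequence a) \<le> 1
        \<longrightarrow> (\<exists>b :: nat \<Rightarrow> 'a complexification.
              order_bounded_sequence (root_sequence b)
              \<and> order_limsup (root_sequence b) = order_limsup (root_sequence a)
              \<and> series_absolutely_order_converges b)
          \<and> (\<exists>c :: nat \<Rightarrow> 'a complexification.
              order_bounded_sequence (root_sequence c)
              \<and> order_limsup (root_sequence c) = order_limsup (root_sequence a)
              \<and> \<not> series_order_converges c))"
proof -
  have "0 \<le> order_limsup (root_sequence a)" if bounded: "order_bounded_sequence (root_sequence a)"
  proof (rule order_limsup_greatest)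
    fix n :: nat
    assume n: "1 \<le> n"
    show "0 \<le> (SUP m\<in>{n..}. root_sequence a m)"
      using root_sequence_power(1)[OF n] le_tail_sup[OF bounded n order_refl] by (rule order_trans)
  qed
  then show ?thesis
    using absolutely_convergent_of_limsup_strongly_below[of a]
      root_sequence_of_order_convergent_series[of a]
      convergent_series_with_limsup divergent_series_with_limsup by blast
qed

end
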